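(* Let $k$ be a field with $\mathrm{char}\,k=0$ or $\mathrm{char}\,k>3$. (i) If $\varphi$ is a strongly Jordan multiplicative nondegenerate diagonal cubic form over $k$, then $\varphi\cong\langle1\rangle$. (ii) If $\varphi$ is a strongly Jordan multiplicative nondegenerate separable cubic form over $k$, then $\varphi\cong\langle1\rangle$.
   Context: A cubic form on a (nonzero) finite-dimensional $k$-vector space $V$ is a map $\varphi:V\to k$ which in coordinates is given by a homogeneous polynomial of degree $3$ over $k$; it corresponds to a unique symmetric trilinear form $\theta$ with $\varphi(v)=\theta(v,v,v)$, and it is nondegenerate if $v=0$ is the only vector with $\theta(v,v_2,v_3)=0$ for all $v_2,v_3\in V$. Two cubic forms are isomorphic ($\cong$) if they correspond to each other under a bijective linear map of the underlying spaces. $\langle a_1,\dots,a_n\rangle$ denotes the cubic form $a_1x_1^3+\dots+a_nx_n^3$; a form which can be written this way (after a linear change of coordinates) is called diagonal. In particular $\langle1\rangle$ is the one-dimensional form $x_1^3$. A form is separable if it becomes isomorphic to a diagonal form over the algebraic closure of $k$. With $n=\dim V$, $X=(x_1,\dots,x_n)$ independent indeterminates, $K=k(X)$ and $\varphi(X)\in K$ the generic value of $\varphi$, $\varphi$ is strongly Jordan multiplicative if $\varphi(X)^2\varphi_K\cong\varphi_K$ over $K$. *)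

theory Defs
  imports
    "HOL-Analysis.Analysis"
    "HOL-Algebra.Algebraic_Closure_Type"
    "HOL-Library.Poly_Mapping"
    "HOL-Computational_Algebra.Fraction_Field"
begin

unbundle no Formal_Power_Series.fps_syntax

text \<open>
  A nonzero finite-dimensional vector space is a type \<open>'v\<close> with a scalar multiplication \<open>scl\<close>
  and a basis \<open>b\<close> indexed by a finite type \<open>'n\<close>, so the dimension is \<open>CARD('n) \<ge> 1\<close>.  The basis
  only serves to introduce coordinates.  A polynomial in variables indexed by \<open>'n\<close> is an element of
  \<open>('n \<Rightarrow>\<^sub>0 nat) \<Rightarrow>\<^sub>0 'k\<close>.  The \<open>linorder\<close> constraint on \<open>'n\<close>, where it occurs, is needed only because
  the library proves that polynomial rings are domains under that constraint; every finite
  cardinality occurs among finite linearly ordered types.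
\<close>

definition is_basis :: "('k::field \<Rightarrow> 'v::ab_group_add \<Rightarrow> 'v) \<Rightarrow> ('n::finite \<Rightarrow> 'v) \<Rightarrow> bool" where
  "is_basis scl b \<longleftrightarrow> vector_space scl \<and> inj b \<and>
     \<not> module.dependent scl (range b) \<and> module.span scl (range b) = UNIV"

definition coords :: "('k::field \<Rightarrow> 'v::ab_group_add \<Rightarrow> 'v) \<Rightarrow> ('n::finite \<Rightarrow> 'v) \<Rightarrow> 'v \<Rightarrow> 'k ^ 'n" where
  "coords scl b v = (\<chi> i. module.representation scl (range b) v (b i))"

definition poly_eval :: "(('n::finite \<Rightarrow>\<^sub>0 nat) \<Rightarrow>\<^sub>0 'k::comm_semiring_1) \<Rightarrow> 'k ^ 'n \<Rightarrow> 'k" where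
  "poly_eval p x = (\<Sum>m\<in>Poly_Mapping.keys p.
     Poly_Mapping.lookup p m * (\<Prod>i\<in>UNIV. (x $ i) ^ Poly_Mapping.lookup m i))"

definition homogeneous_poly :: "nat \<Rightarrow> (('n::finite \<Rightarrow>\<^sub>0 nat) \<Rightarrow>\<^sub>0 'k::zero) \<Rightarrow> bool" where
  "homogeneous_poly d p \<longleftrightarrow> (\<forall>m\<in>Poly_Mapping.keys p. (\<Sum>i\<in>UNIV. Poly_Mapping.lookup m i) = d)"

definition cubic_form ::
  "('k::field \<Rightarrow> 'v::ab_group_add \<Rightarrow> 'v) \<Rightarrow> ('n::finite \<Rightarrow> 'v) \<Rightarrow> ('v \<Rightarrow> 'k) \<Rightarrow> bool" where
  "cubic_form scl b \<phi> \<longleftrightarrow>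
     (\<exists>p. homogeneous_poly 3 p \<and> (\<forall>v. \<phi> v = poly_eval p (coords scl b v)))"

definition trilinear ::
  "('k::field \<Rightarrow> 'v::ab_group_add \<Rightarrow> 'v) \<Rightarrow> ('v \<Rightarrow> 'v \<Rightarrow> 'v \<Rightarrow> 'k) \<Rightarrow> bool" where
  "trilinear scl \<theta> \<longleftrightarrow>
     (\<forall>v w. Vector_Spaces.linear scl (*) (\<lambda>u. \<theta> u v w)) \<and>
     (\<forall>u w. Vector_Spaces.linear scl (*) (\<lambda>v. \<theta> u v w)) \<and>
     (\<forall>u v. Vector_Spaces.linear scl (*) (\<lambda>w. \<theta> u v w))"

definition symmetric3 :: "('v \<Rightarrow> 'v \<Rightarrow> 'v \<Rightarrow> 'k) \<Rightarrow> bool" where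
  "symmetric3 \<theta> \<longleftrightarrow> (\<forall>u v w. \<theta> u v w = \<theta> v u w \<and> \<theta> u v w = \<theta> u w v)"

text \<open>Existence and uniqueness of \<open>polar_form scl \<phi>\<close> for cubic forms: lemma \<open>ex1_polar_form\<close> below.\<close>

definition polar_form ::
  "('k::field \<Rightarrow> 'v::ab_group_add \<Rightarrow> 'v) \<Rightarrow> ('v \<Rightarrow> 'k) \<Rightarrow> 'v \<Rightarrow> 'v \<Rightarrow> 'v \<Rightarrow> 'k" where
  "polar_form scl \<phi> =
     (THE \<theta>. trilinear scl \<theta> \<and> symmetric3 \<theta> \<and> (\<forall>v. \<phi> v = \<theta> v v v))"

definition nondegenerate ::
  "('k::field \<Rightarrow> 'v::ab_group_add \<Rightarrow> 'v) \<Rightarrow> ('v \<Rightarrow> 'k) \<Rightarrow> bool" where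
  "nondegenerate scl \<phi> \<longleftrightarrow>
     (\<forall>v. (\<forall>v2 v3. polar_form scl \<phi> v v2 v3 = 0) \<longrightarrow> v = 0)"

definition isomorphic_forms ::
  "('k::field \<Rightarrow> 'v::ab_group_add \<Rightarrow> 'v) \<Rightarrow> ('v \<Rightarrow> 'k) \<Rightarrow>
   ('k \<Rightarrow> 'w::ab_group_add \<Rightarrow> 'w) \<Rightarrow> ('w \<Rightarrow> 'k) \<Rightarrow> bool" where
  "isomorphic_forms scl \<phi> scl' \<psi> \<longleftrightarrow>
     (\<exists>f. Vector_Spaces.linear scl scl' f \<and> bij f \<and> (\<forall>v. \<psi> (f v) = \<phi> v))"

definition diag_form :: "('n::finite \<Rightarrow> 'k::comm_semiring_1) \<Rightarrow> 'k ^ 'n \<Rightarrow> 'k" where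
  "diag_form a x = (\<Sum>i\<in>UNIV. a i * (x $ i) ^ 3)"

definition diagonal ::
  "('k::field \<Rightarrow> 'v::ab_group_add \<Rightarrow> 'v) \<Rightarrow> ('n::finite \<Rightarrow> 'v) \<Rightarrow> ('v \<Rightarrow> 'k) \<Rightarrow> bool" where
  "diagonal scl b \<phi> \<longleftrightarrow>
     (\<exists>a. isomorphic_forms scl \<phi> scl (\<lambda>v. diag_form a (coords scl b v)))"

text \<open>
  Extension of scalars along a field embedding \<open>h\<close>: the basis \<open>b\<close> identifies the extended space
  with \<open>'l ^ 'n\<close>, and the symmetric trilinear form is extended \<open>'l\<close>-trilinearly.  In terms of
  polynomials this applies \<open>h\<close> to all coefficients, see lemma \<open>extend_form_poly\<close> below.
\<close>

definition extend_form ::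
  "('k::field \<Rightarrow> 'l::field) \<Rightarrow> ('k \<Rightarrow> 'v::ab_group_add \<Rightarrow> 'v) \<Rightarrow> ('n::finite \<Rightarrow> 'v) \<Rightarrow>
   ('v \<Rightarrow> 'k) \<Rightarrow> 'l ^ 'n \<Rightarrow> 'l" where
  "extend_form h scl b \<phi> x =
     (\<Sum>i\<in>UNIV. \<Sum>j\<in>UNIV. \<Sum>l\<in>UNIV.
        h (polar_form scl \<phi> (b i) (b j) (b l)) * x $ i * x $ j * x $ l)"

definition separable ::
  "('k::field \<Rightarrow> 'v::ab_group_add \<Rightarrow> 'v) \<Rightarrow> ('n::finite \<Rightarrow> 'v) \<Rightarrow> ('v \<Rightarrow> 'k) \<Rightarrow> bool" where
  "separable scl b \<phi> \<longleftrightarrow>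
     (\<exists>a :: 'n \<Rightarrow> 'k alg_closure.
        isomorphic_forms (*s) (extend_form to_ac scl b \<phi>) (*s) (diag_form a))"

type_synonym ('n, 'k) ratfun = "(('n \<Rightarrow>\<^sub>0 nat) \<Rightarrow>\<^sub>0 'k) fract"

definition rf_const :: "'k::field \<Rightarrow> ('n::{finite,linorder}, 'k) ratfun" where
  "rf_const c = Fract (Poly_Mapping.single 0 c) 1"

definition generic_vec :: "(('n::{finite,linorder}, 'k::field) ratfun, 'n) vec" where
  "generic_vec = (\<chi> i. Fract (Poly_Mapping.single (Poly_Mapping.single i 1) 1) 1)"

definition strongly_Jordan_multiplicative ::
  "('k::field \<Rightarrow> 'v::ab_group_add \<Rightarrow> 'v) \<Rightarrow> ('n::{finite,linorder} \<Rightarrow> 'v) \<Rightarrow> ('v \<Rightarrow> 'k) \<Rightarrow> bool" where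
  "strongly_Jordan_multiplicative scl b \<phi> \<longleftrightarrow>
     (let \<phi>K :: (('n, 'k) ratfun, 'n) vec \<Rightarrow> ('n, 'k) ratfun = extend_form rf_const scl b \<phi>
      in isomorphic_forms (*s) (\<lambda>x. (\<phi>K generic_vec)^2 * \<phi>K x) (*s) \<phi>K)"

lemma six_nonzero:
  assumes "CHAR('k::field) = 0 \<or> CHAR('k) > 3"
  shows "(6::'k) \<noteq> 0"
proof
  assume "(6::'k) = 0"
  hence "of_nat 6 = (0::'k)" by simp
  hence d: "CHAR('k) dvd 6" using of_nat_eq_0_iff_char_dvd by blast
  hence "CHAR('k) \<noteq> 0" by (metis dvd_0_left zero_neq_numeral)
  with assms have g: "CHAR('k) > 3" by simp
  hence "Factorial_Ring.prime CHAR('k)" by (intro prime_CHAR_semidom) simp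
  moreover have "CHAR('k) dvd 2 * 3" using d by simp
  ultimately have "CHAR('k) dvd 2 \<or> CHAR('k) dvd 3" by (simp only: prime_dvd_mult_iff)
  thus False using g by (auto dest: dvd_imp_le)
qed

lemma polar_form_unique:
  fixes \<theta> :: "'v::ab_group_add \<Rightarrow> 'v \<Rightarrow> 'v \<Rightarrow> 'k::field"
  assumes "(6::'k) \<noteq> 0" and t: "trilinear scl \<theta>" "symmetric3 \<theta>" "\<And>v. \<phi> v = \<theta> v v v"
  shows "\<theta> u v w = (\<phi> (u+v+w) - \<phi> (u+v) - \<phi> (u+w) - \<phi> (v+w) + \<phi> u + \<phi> v + \<phi> w) / 6"
proof -
  have l: "\<theta> (x+y) z z' = \<theta> x z z' + \<theta> y z z'" "\<theta> z (x+y) z' = \<theta> z x z' + \<theta> z y z'"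
      "\<theta> z z' (x+y) = \<theta> z z' x + \<theta> z z' y" for x y z z'
    using t(1) unfolding trilinear_def Vector_Spaces.linear_def module_hom_def module_hom_axioms_def by blast+
  have s: "\<theta> x y z = \<theta> y x z" "\<theta> x y z = \<theta> x z y" for x y z
    using t(2) unfolding symmetric3_def by blast+
  have "\<phi> (u+v+w) - \<phi> (u+v) - \<phi> (u+w) - \<phi> (v+w) + \<phi> u + \<phi> v + \<phi> w = \<theta> u v w + \<theta> u w v + \<theta> v u w
     + \<theta> v w u + \<theta> w u v + \<theta> w v u"
    unfolding t(3) l by (simp add: algebra_simps)
  also have "\<dots> = 6 * \<theta> u v w"
  proof -
    have "\<theta> u w v = \<theta> u v w" by (rule s(2))
    moreover have "\<theta> v u w = \<theta> u v w" by (rule s(1))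
    moreover have "\<theta> v w u = \<theta> u v w" by (rule trans[OF s(2) s(1)])
    moreover have "\<theta> w u v = \<theta> u v w" by (rule trans[OF s(1) s(2)])
    moreover have "\<theta> w v u = \<theta> u v w" by (rule trans[OF s(1) trans[OF s(2) s(1)]])
    ultimately show ?thesis by (simp only:) simp
  qed
  finally show ?thesis by (simp only: nonzero_mult_div_cancel_left[OF assms(1)])
qed

lemma exponent3:
  fixes f :: "'n::finite \<Rightarrow> nat"
  assumes "(\<Sum>i\<in>UNIV. f i) = 3"
  shows "\<exists>i j l. \<forall>t. f t = of_bool (t = i) + of_bool (t = j) + of_bool (t = l)"
proof -
  have step: "\<exists>i g. (\<Sum>t\<in>UNIV. g t) = d \<and> (\<forall>t. f t = of_bool (t = i) + g t)"
    if "(\<Sum>t\<in>UNIV. f t) = Suc d" for d and f :: "'n \<Rightarrow> nat"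
  proof -
    have "\<exists>i. f i > 0" by (rule ccontr) (use that in simp)
    then obtain i where i: "f i > 0" ..
    define g where "g = f(i := f i - 1)"
    have f: "f t = of_bool (t = i) + g t" for t using i by (simp add: g_def)
    have "(\<Sum>t\<in>UNIV. f t) = (\<Sum>t\<in>UNIV. of_bool (t = i)) + (\<Sum>t\<in>UNIV. g t)"
      by (simp only: f sum.distrib)
    also have "(\<Sum>t\<in>UNIV. of_bool (t = i) :: nat) = 1" by (simp add: of_bool_def)
    finally have "(\<Sum>t\<in>UNIV. g t) = d" using that by simp
    with f show ?thesis by blast
  qed
  have "(\<Sum>t\<in>UNIV. f t) = Suc 2" using assms by simp
  then obtain i g where g: "(\<Sum>t\<in>UNIV. g t) = 2" "\<And>t. f t = of_bool (t = i) + g t"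
    using step by blast
  from g(1) have "(\<Sum>t\<in>UNIV. g t) = Suc 1" by simp
  then obtain j h where h: "(\<Sum>t\<in>UNIV. h t) = 1" "\<And>t. g t = of_bool (t = j) + h t"
    using step by blast
  from h(1) have "(\<Sum>t\<in>UNIV. h t) = Suc 0" by simp
  then obtain l e where e: "(\<Sum>t\<in>UNIV. e t) = 0" "\<And>t. h t = of_bool (t = l) + e t"
    using step by blast
  from e(1) have "e t = 0" for t by simp
  hence "f t = of_bool (t = i) + of_bool (t = j) + of_bool (t = l)" for t
    by (simp only: g(2) h(2) e(2))
  thus ?thesis by blast
qed

lemma prod_exponent3:
  fixes x :: "'k::comm_semiring_1 ^ 'n::finite"
  assumes "\<And>t. f t = of_bool (t = i) + of_bool (t = j) + of_bool (t = l)"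
  shows "(\<Prod>t\<in>UNIV. x $ t ^ f t) = x $ i * x $ j * x $ l"
proof -
  have "(\<Prod>t\<in>UNIV. x $ t ^ of_bool (t = a)) = x $ a" for a
  proof -
    have "(\<Prod>t\<in>UNIV. x $ t ^ of_bool (t = a)) = (\<Prod>t\<in>UNIV. if t = a then x $ t else 1)"
      by (rule prod.cong) auto
    thus ?thesis by simp
  qed
  thus ?thesis by (simp add: assms power_add prod.distrib)
qed

lemma sum_of_bool_eq:
  fixes F :: "'n::finite \<Rightarrow> 'k::field"
  shows "(\<Sum>t\<in>UNIV. of_bool (t = a) * F t) = F a"
proof -
  have "(\<Sum>t\<in>UNIV. of_bool (t = a) * F t) = (\<Sum>t\<in>UNIV. if t = a then F t else 0)"
    by (rule sum.cong) auto
  thus ?thesis by simp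
qed

lemma homogeneous_poly_array:
  fixes p :: "('n::finite \<Rightarrow>\<^sub>0 nat) \<Rightarrow>\<^sub>0 'k::field" and h :: "'k \<Rightarrow> 'l::field"
  assumes six: "(6::'k) \<noteq> 0" and p: "homogeneous_poly 3 p"
    and h: "h 1 = 1" "\<And>a b. h (a + b) = h a + h b" "\<And>a b. h (a * b) = h a * h b"
  shows "\<exists>c :: 'n \<Rightarrow> 'n \<Rightarrow> 'n \<Rightarrow> 'k. symmetric3 c \<and>
    (\<forall>x. poly_eval p x = (\<Sum>i\<in>UNIV. \<Sum>j\<in>UNIV. \<Sum>l\<in>UNIV. c i j l * x $ i * x $ j * x $ l)) \<and>
    (\<forall>x. poly_eval (Poly_Mapping.map h p) x =
       (\<Sum>i\<in>UNIV. \<Sum>j\<in>UNIV. \<Sum>l\<in>UNIV. h (c i j l) * x $ i * x $ j * x $ l))"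
proof -
  have h0: "h 0 = 0" using h(2)[of 0 0] by (metis add_0 add_cancel_right_right)
  have hsum: "h (sum g A) = (\<Sum>t\<in>A. h (g t))" for g :: "('n \<Rightarrow>\<^sub>0 nat) \<Rightarrow> 'k" and A
    by (induction A rule: infinite_finite_induct) (auto simp: h0 h)
  have hnat: "h (of_nat n) = of_nat n" for n by (induction n) (auto simp: h0 h)
  have "h 6 * h (1 / 6) = 1" using six by (simp flip: h(3) add: h(1))
  moreover have "h 6 = 6" using hnat[of 6] by simp
  ultimately have six': "(6::'l) \<noteq> 0" by auto
  have "\<forall>m\<in>Poly_Mapping.keys p. \<exists>r :: 'n \<times> 'n \<times> 'n. \<forall>t. Poly_Mapping.lookup m t =
      of_bool (t = fst r) + of_bool (t = fst (snd r)) + of_bool (t = snd (snd r))"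
  proof
    fix m assume "m \<in> Poly_Mapping.keys p"
    hence "(\<Sum>i\<in>UNIV. Poly_Mapping.lookup m i) = 3" using p by (simp add: homogeneous_poly_def)
    from exponent3[OF this] obtain i j l where
      "\<forall>t. Poly_Mapping.lookup m t = of_bool (t = i) + of_bool (t = j) + of_bool (t = l)" by blast
    thus "\<exists>r :: 'n \<times> 'n \<times> 'n. \<forall>t. Poly_Mapping.lookup m t =
        of_bool (t = fst r) + of_bool (t = fst (snd r)) + of_bool (t = snd (snd r))"
      by (intro exI[of _ "(i, j, l)"]) (simp only: fst_conv snd_conv simp_thms)
  qed
  from bchoice[OF this] obtain R where R: "\<forall>m\<in>Poly_Mapping.keys p. \<forall>t. Poly_Mapping.lookup m t =
      of_bool (t = fst (R m)) + of_bool (t = fst (snd (R m))) + of_bool (t = snd (snd (R m)))" ..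
  define I J L where "I m = fst (R m)" and "J m = fst (snd (R m))" and "L m = snd (snd (R m))" for m
  have ijl: "Poly_Mapping.lookup m t = of_bool (t = I m) + of_bool (t = J m) + of_bool (t = L m)"
    if "m \<in> Poly_Mapping.keys p" for m t
    using R that by (simp only: I_def J_def L_def)
  define e :: "'n \<Rightarrow> 'n \<Rightarrow> 'n \<Rightarrow> 'n \<Rightarrow> 'n \<Rightarrow> 'n \<Rightarrow> nat" where
    "e a b c i j l = of_bool (i = a) * of_bool (j = b) * of_bool (l = c)" for a b c i j l
  define d where "d m i j l = e (I m) (J m) (L m) i j l + e (I m) (L m) (J m) i j l
     + e (J m) (I m) (L m) i j l + e (J m) (L m) (I m) i j l
     + e (L m) (I m) (J m) i j l + e (L m) (J m) (I m) i j l" for m i j l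
  define c where "c i j l = (\<Sum>m\<in>Poly_Mapping.keys p. Poly_Mapping.lookup p m * (1 / 6) * of_nat (d m i j l))"
    for i j l
  have "d m i j l = d m j i l" for m i j l
    unfolding d_def e_def by (simp only: ac_simps)
  moreover have "d m i j l = d m i l j" for m i j l
    unfolding d_def e_def by (simp only: ac_simps)
  ultimately have "d m i j l = d m j i l \<and> d m i j l = d m i l j" for m i j l by blast
  hence "c i j l = c j i l" "c i j l = c i l j" for i j l
    unfolding c_def by (auto intro!: sum.cong)
  hence sym: "symmetric3 c" unfolding symmetric3_def by blast
  have main: "(\<Sum>i\<in>UNIV. \<Sum>j\<in>UNIV. \<Sum>l\<in>UNIV.
       (\<Sum>m\<in>Poly_Mapping.keys p. q m * s * of_nat (d m i j l)) * x $ i * x $ j * x $ l)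
     = (\<Sum>m\<in>Poly_Mapping.keys p. q m * (x $ I m * x $ J m * x $ L m))"
    if s: "s * 6 = 1" for q and s :: "'f::field" and x :: "'f ^ 'n"
  proof -
    have E: "(\<Sum>i\<in>UNIV. \<Sum>j\<in>UNIV. \<Sum>l\<in>UNIV. of_nat (e a b c i j l) * (x $ i * x $ j * x $ l))
        = x $ a * x $ b * x $ c" for a b c
    proof -
      have "of_nat (e a b c i j l) * (x $ i * x $ j * x $ l) =
        of_bool (i = a) * (of_bool (j = b) * (of_bool (l = c) * (x $ i * x $ j * x $ l)))" for i j l
        by (simp add: e_def)
      thus ?thesis by (simp only: sum_distrib_left[symmetric] sum_of_bool_eq)
    qed
    have "(\<Sum>i\<in>UNIV. \<Sum>j\<in>UNIV. \<Sum>l\<in>UNIV.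
       (\<Sum>m\<in>Poly_Mapping.keys p. q m * s * of_nat (d m i j l)) * x $ i * x $ j * x $ l)
      = (\<Sum>i\<in>UNIV. \<Sum>j\<in>UNIV. \<Sum>l\<in>UNIV. \<Sum>m\<in>Poly_Mapping.keys p.
          q m * s * (of_nat (d m i j l) * (x $ i * x $ j * x $ l)))"
      by (simp add: sum_distrib_right mult.assoc)
    also have "\<dots> = (\<Sum>m\<in>Poly_Mapping.keys p. \<Sum>i\<in>UNIV. \<Sum>j\<in>UNIV. \<Sum>l\<in>UNIV.
          q m * s * (of_nat (d m i j l) * (x $ i * x $ j * x $ l)))"
      by (simp only: sum.swap[of _ "Poly_Mapping.keys p" UNIV])
    also have "\<dots> = (\<Sum>m\<in>Poly_Mapping.keys p. q m * s * (\<Sum>i\<in>UNIV. \<Sum>j\<in>UNIV. \<Sum>l\<in>UNIV.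
          (of_nat (d m i j l) * (x $ i * x $ j * x $ l))))"
      by (simp add: sum_distrib_left)
    also have "\<dots> = (\<Sum>m\<in>Poly_Mapping.keys p. q m * s * (6 * (x $ I m * x $ J m * x $ L m)))"
      (is "sum ?f _ = sum ?g _")
    proof (rule sum.cong[OF refl])
      fix m
      have "(\<Sum>i\<in>UNIV. \<Sum>j\<in>UNIV. \<Sum>l\<in>UNIV. of_nat (d m i j l) * (x $ i * x $ j * x $ l))
        = x $ I m * x $ J m * x $ L m + x $ I m * x $ L m * x $ J m + x $ J m * x $ I m * x $ L m
        + x $ J m * x $ L m * x $ I m + x $ L m * x $ I m * x $ J m + x $ L m * x $ J m * x $ I m"
        unfolding d_def by (simp only: of_nat_add distrib_right sum.distrib E)
      also have "\<dots> = 6 * (x $ I m * x $ J m * x $ L m)"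
        by (simp add: algebra_simps)
      finally show "?f m = ?g m" by (simp only:)
    qed
    also have "\<dots> = (\<Sum>m\<in>Poly_Mapping.keys p. q m * (x $ I m * x $ J m * x $ L m))"
      (is "sum ?f _ = sum ?g _")
    proof (rule sum.cong[OF refl])
      fix m
      have "?f m = q m * (s * 6) * (x $ I m * x $ J m * x $ L m)" by (simp only: ac_simps)
      thus "?f m = ?g m" using s by simp
    qed
    finally show ?thesis .
  qed
  have ev: "poly_eval p x = (\<Sum>m\<in>Poly_Mapping.keys p. Poly_Mapping.lookup p m * (x $ I m * x $ J m * x $ L m))" for x
    unfolding poly_eval_def by (rule sum.cong) (simp_all add: prod_exponent3[OF ijl])
  have "poly_eval (Poly_Mapping.map h p) x = (\<Sum>m\<in>Poly_Mapping.keys p.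
     Poly_Mapping.lookup (Poly_Mapping.map h p) m * (\<Prod>i\<in>UNIV. (x $ i) ^ Poly_Mapping.lookup m i))" for x
    unfolding poly_eval_def
    by (rule sum.mono_neutral_left) (auto simp: in_keys_iff map.rep_eq when_def)
  also have "\<dots> x = (\<Sum>m\<in>Poly_Mapping.keys p. h (Poly_Mapping.lookup p m) * (x $ I m * x $ J m * x $ L m))" for x
    by (rule sum.cong) (simp_all add: prod_exponent3[OF ijl] map.rep_eq when_def in_keys_iff)
  finally have ev': "poly_eval (Poly_Mapping.map h p) x =
     (\<Sum>m\<in>Poly_Mapping.keys p. h (Poly_Mapping.lookup p m) * (x $ I m * x $ J m * x $ L m))" for x .
  have hc: "h (c i j l) = (\<Sum>m\<in>Poly_Mapping.keys p. h (Poly_Mapping.lookup p m) * h (1 / 6) * of_nat (d m i j l))"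
    for i j l unfolding c_def by (simp only: hsum h(3) hnat)
  have "h (1 / 6) * 6 = 1" using \<open>h 6 * h (1 / 6) = 1\<close> \<open>h 6 = 6\<close> by (simp add: mult.commute)
  from main[OF this] have "poly_eval (Poly_Mapping.map h p) x =
       (\<Sum>i\<in>UNIV. \<Sum>j\<in>UNIV. \<Sum>l\<in>UNIV. h (c i j l) * x $ i * x $ j * x $ l)" for x
    unfolding ev' hc by simp
  moreover have "(1 / 6 :: 'k) * 6 = 1" using six by simp
  hence "poly_eval p x = (\<Sum>i\<in>UNIV. \<Sum>j\<in>UNIV. \<Sum>l\<in>UNIV. c i j l * x $ i * x $ j * x $ l)" for x
    unfolding ev c_def by (rule main[symmetric])
  ultimately show ?thesis using sym by blast
qed

lemma linear_coords:
  assumes "is_basis scl b"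
  shows "coords scl b (x + y) = coords scl b x + coords scl b y"
    and "coords scl b (scl r x) = r *s coords scl b x"
    and "coords scl b (b i) = axis i 1"
proof -
  interpret vector_space scl using assms by (simp add: is_basis_def)
  have b: "inj b" "independent (range b)" "span (range b) = UNIV"
    using assms by (simp_all add: is_basis_def)
  show "coords scl b (x + y) = coords scl b x + coords scl b y"
    by (simp add: coords_def vec_eq_iff representation_add b)
  show "coords scl b (scl r x) = r *s coords scl b x"
    by (simp add: coords_def vec_eq_iff representation_scale b)
  show "coords scl b (b i) = axis i 1"
    using b by (auto simp: coords_def vec_eq_iff representation_basis axis_def inj_eq)
qed

lemma trilinear_array:
  fixes scl :: "'k::field \<Rightarrow> 'v::ab_group_add \<Rightarrow> 'v" and b :: "'n::finite \<Rightarrow> 'v"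
  assumes "is_basis scl b" "symmetric3 c"
  defines "\<theta> \<equiv> \<lambda>u v w. \<Sum>i\<in>UNIV. \<Sum>j\<in>UNIV. \<Sum>l\<in>UNIV.
    c i j l * coords scl b u $ i * coords scl b v $ j * coords scl b w $ l"
  shows "trilinear scl \<theta>" "symmetric3 \<theta>" "\<theta> (b i) (b j) (b l) = c i j l"
proof -
  have vs: "vector_space scl" using assms by (simp add: is_basis_def)
  have vk: "vector_space ((*) :: 'k \<Rightarrow> 'k \<Rightarrow> 'k)" by unfold_locales (auto simp: algebra_simps)
  show "trilinear scl \<theta>"
    unfolding trilinear_def \<theta>_def Vector_Spaces.linear_def module_hom_def module_hom_axioms_def
    using vs vk module_iff_vector_space[of scl] module_iff_vector_space[of "(*) :: 'k \<Rightarrow> 'k \<Rightarrow> 'k"]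
    by (simp add: linear_coords[OF assms(1)] distrib_left distrib_right sum.distrib sum_distrib_left ac_simps)
  have s: "c i j l = c j i l" "c i j l = c i l j" for i j l
    using assms(2) unfolding symmetric3_def by blast+
  have "\<theta> u v w = \<theta> v u w" for u v w
    unfolding \<theta>_def
    by (subst sum.swap, intro sum.cong refl, subst s(1)) (simp add: ac_simps)
  moreover have "\<theta> u v w = \<theta> u w v" for u v w
    unfolding \<theta>_def
    by (rule sum.cong[OF refl], subst sum.swap, intro sum.cong refl, subst s(2)) (simp add: ac_simps)
  ultimately show "symmetric3 \<theta>" unfolding symmetric3_def by blast
  have "c i' j' l' * axis i 1 $ i' * axis j 1 $ j' * axis l 1 $ l' =
     of_bool (i' = i) * (of_bool (j' = j) * (of_bool (l' = l) * c i' j' l'))" for i' j' l'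
    by (simp add: axis_def)
  thus "\<theta> (b i) (b j) (b l) = c i j l"
    unfolding \<theta>_def linear_coords(3)[OF assms(1)]
    by (simp only: sum_distrib_left[symmetric] sum_of_bool_eq)
qed

lemma polar_form_eqI:
  fixes scl :: "'k::field \<Rightarrow> 'v::ab_group_add \<Rightarrow> 'v"
  assumes "(6::'k) \<noteq> 0" "trilinear scl \<theta>" "symmetric3 \<theta>" "\<And>v. \<phi> v = \<theta> v v v"
  shows "polar_form scl \<phi> = \<theta>"
  unfolding polar_form_def
proof (rule the_equality)
  show "trilinear scl \<theta> \<and> symmetric3 \<theta> \<and> (\<forall>v. \<phi> v = \<theta> v v v)" using assms by blast
next
  fix \<theta>' assume t': "trilinear scl \<theta>' \<and> symmetric3 \<theta>' \<and> (\<forall>v. \<phi> v = \<theta>' v v v)"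
  hence e: "\<And>v. \<phi> v = \<theta>' v v v" by blast
  have "\<theta>' u v w = \<theta> u v w" for u v w
    using polar_form_unique[OF assms(1) conjunct1[OF t'] conjunct1[OF conjunct2[OF t']] e, of u v w]
      polar_form_unique[OF assms, of u v w] by (rule trans[OF _ sym])
  thus "\<theta>' = \<theta>" by (intro ext)
qed

lemma ex1_polar_form:
  fixes scl :: "'k::field \<Rightarrow> 'v::ab_group_add \<Rightarrow> 'v"
  assumes "CHAR('k) = 0 \<or> CHAR('k) > 3" "is_basis scl b" "cubic_form scl b \<phi>"
  shows "\<exists>!\<theta>. trilinear scl \<theta> \<and> symmetric3 \<theta> \<and> (\<forall>v. \<phi> v = \<theta> v v v)"
proof -
  note six = six_nonzero[OF assms(1)]
  obtain p where p: "homogeneous_poly 3 p" "\<And>v. \<phi> v = poly_eval p (coords scl b v)"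
    using assms(3) unfolding cubic_form_def by blast
  obtain c where c: "symmetric3 c"
    "\<And>x. poly_eval p x = (\<Sum>i\<in>UNIV. \<Sum>j\<in>UNIV. \<Sum>l\<in>UNIV. c i j l * x $ i * x $ j * x $ l)"
    using homogeneous_poly_array[OF six p(1), of "\<lambda>x. x"] by auto
  note t = trilinear_array[OF assms(2) c(1)]
  show ?thesis
  proof (rule ex_ex1I)
    show "\<exists>\<theta>. trilinear scl \<theta> \<and> symmetric3 \<theta> \<and> (\<forall>v. \<phi> v = \<theta> v v v)"
      using t(1,2) p(2) c(2) by (intro exI conjI) auto
  next
    fix \<theta> \<theta>'
    assume a: "trilinear scl \<theta> \<and> symmetric3 \<theta> \<and> (\<forall>v. \<phi> v = \<theta> v v v)"
      and a': "trilinear scl \<theta>' \<and> symmetric3 \<theta>' \<and> (\<forall>v. \<phi> v = \<theta>' v v v)"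
    have "polar_form scl \<phi> = \<theta>" using a by (intro polar_form_eqI[OF six]) blast+
    moreover have "polar_form scl \<phi> = \<theta>'" using a' by (intro polar_form_eqI[OF six]) blast+
    ultimately show "\<theta> = \<theta>'" by (simp only:)
  qed
qed

lemma extend_form_poly:
  fixes scl :: "'k::field \<Rightarrow> 'v::ab_group_add \<Rightarrow> 'v" and h :: "'k \<Rightarrow> 'l::field"
    and b :: "'n::finite \<Rightarrow> 'v"
  assumes "CHAR('k) = 0 \<or> CHAR('k) > 3" "is_basis scl b"
    and p: "homogeneous_poly 3 p" "\<And>v. \<phi> v = poly_eval p (coords scl b v)"
    and h: "h 1 = 1" "\<And>a b. h (a + b) = h a + h b" "\<And>a b. h (a * b) = h a * h b"
  shows "extend_form h scl b \<phi> x = poly_eval (Poly_Mapping.map h p) x"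
proof -
  note six = six_nonzero[OF assms(1)]
  obtain c where c: "symmetric3 c"
    "\<And>x. poly_eval p x = (\<Sum>i\<in>UNIV. \<Sum>j\<in>UNIV. \<Sum>l\<in>UNIV. c i j l * x $ i * x $ j * x $ l)"
    "\<And>x. poly_eval (Poly_Mapping.map h p) x =
       (\<Sum>i\<in>UNIV. \<Sum>j\<in>UNIV. \<Sum>l\<in>UNIV. h (c i j l) * x $ i * x $ j * x $ l)"
    using homogeneous_poly_array[of p h, OF six p(1) h] by blast
  note t = trilinear_array[OF assms(2) c(1)]
  have "polar_form scl \<phi> (b i) (b j) (b l) = c i j l" for i j l
    by (subst polar_form_eqI[OF six t(1,2)]) (simp_all only: p(2) c(2) t(3))
  thus ?thesis by (simp add: extend_form_def c(3))
qed

end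

theory Submission
  imports Defs
begin

text \<open>
  A diagonal form over \<open>k\<close> is separable, so both parts follow from two facts: the dimension is one if
  the form becomes diagonal over the algebraic closure of \<open>k\<close>, and a one-dimensional form \<open>c x^3\<close> that
  is strongly Jordan multiplicative has a cube \<open>c\<close>.

  An isomorphism between \<open>\<phi>(X)^2 \<phi>\<close> and \<open>\<phi>\<close> over \<open>k(X)\<close> is a similitude with factor \<open>\<phi>(X)^2\<close>.
  A similitude of a nondegenerate diagonal form is a monomial matrix
  (\<open>rows_of_diagonal_similitude\<close>); therefore its factor is a cube times a constant
  (\<open>diagonal_similitude_factor\<close>).  So \<open>\<phi>(X)^2\<close>, and with it \<open>\<phi>(X)\<close>, would be a cube up to
  constants.  But in dimension at least two, the restriction of a diagonal form with
  nonzero coefficients to a suitable line over the algebraic closure has a simple root.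

  To keep the argument within univariate polynomials, the similitude is first written with
  polynomial entries and a common denominator \<open>q\<close> (\<open>similitude_over_polynomials\<close>), and then \<open>X\<close> is
  replaced by a line \<open>w + t v\<close> over the algebraic closure on which \<open>q\<close> does not vanish identically
  (\<open>exists_meval_nonzero\<close>).  The diagonalization is used only after this substitution, and the
  contradiction comes from the order of the factor at a simple root (\<open>dimension_one_if_similitude\<close>).

  In dimension one the factor is \<open>c^2 X^6\<close>, so \<open>c^2\<close> is a cube in \<open>k(X)\<close>; comparing leading coefficients
  shows that it is one in \<open>k\<close> (\<open>cube_if_similitude_dimension_one\<close>).
\<close>

section \<open>Ring homomorphisms and evaluation of multivariate polynomials\<close>

locale unital_hom =
  fixes h :: "'a::comm_ring_1 \<Rightarrow> 'b::comm_ring_1"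
  assumes hom_1: "h 1 = 1"
    and hom_add: "h (a + b) = h a + h b"
    and hom_mult: "h (a * b) = h a * h b"
begin

lemma hom_0: "h 0 = 0"
  using hom_add[of 0 0] by simp

lemma hom_sum: "h (sum f A) = (\<Sum>t\<in>A. h (f t))"
  by (induction A rule: infinite_finite_induct) (auto simp: hom_0 hom_add)

lemma hom_prod: "h (prod f A) = (\<Prod>t\<in>A. h (f t))"
  by (induction A rule: infinite_finite_induct) (auto simp: hom_1 hom_mult)

lemma hom_power: "h (a ^ n) = h a ^ n"
  by (induction n) (auto simp: hom_1 hom_mult)

lemma hom_of_nat: "h (of_nat n) = of_nat n"
  by (induction n) (auto simp: hom_1 hom_0 hom_add)

lemma hom_numeral: "h (numeral n) = numeral n"
  using hom_of_nat[of "numeral n"] by simp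

lemmas homs = hom_0 hom_1 hom_add hom_mult hom_sum hom_prod hom_power hom_numeral

end

lemma unital_hom_compose:
  assumes "unital_hom f" "unital_hom g"
  shows "unital_hom (\<lambda>x. g (f x))"
  using assms by (simp add: unital_hom_def)

lemma unital_hom_field_eq_0_iff:
  fixes h :: "'a::field \<Rightarrow> 'b::comm_ring_1"
  assumes "unital_hom h"
  shows "h a = 0 \<longleftrightarrow> a = 0"
proof -
  interpret unital_hom h by fact
  have "h a * h (inverse a) = 1" if "a \<noteq> 0"
    using that by (simp flip: hom_mult add: hom_1)
  thus ?thesis using hom_0 by force
qed

lemma unital_hom_to_ac: "unital_hom to_ac"
  by unfold_locales auto

lemma unital_hom_const_poly: "unital_hom (\<lambda>c. [:c:])"
  by unfold_locales (auto simp: one_pCons)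

lemma unital_hom_poly: "unital_hom (\<lambda>p. poly p s)"
  by unfold_locales auto

lemma unital_hom_Fract: "unital_hom (\<lambda>p::'a::idom. Fract p 1)"
  by unfold_locales (auto simp: One_fract_def)

lemma unital_hom_single: "unital_hom (Poly_Mapping.single (0::'m::comm_monoid_add) :: 'k::comm_ring_1 \<Rightarrow> _)"
  by unfold_locales (auto simp: single_add mult_single)

text \<open>
  Evaluation of a multivariate polynomial at a point over another ring, with the coefficients sent
  through \<open>h\<close>.  Separating \<open>h\<close> from the point allows points over \<open>k\<close>, over its algebraic closure and
  over a univariate polynomial ring, where a point with linear components is a line.
\<close>
definition meval ::
  "('k::comm_ring_1 \<Rightarrow> 'r::comm_ring_1) \<Rightarrow> 'r ^ 'n::finite \<Rightarrow> (('n \<Rightarrow>\<^sub>0 nat) \<Rightarrow>\<^sub>0 'k) \<Rightarrow> 'r" where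
  "meval h x p = (\<Sum>m\<in>Poly_Mapping.keys p.
     h (Poly_Mapping.lookup p m) * (\<Prod>i\<in>UNIV. (x $ i) ^ Poly_Mapping.lookup m i))"

text \<open>
  Coefficients outside the support vanish, so that two polynomials can be evaluated over a common
  set of monomials.
\<close>
lemma meval_superset:
  assumes "unital_hom h" "finite M" "Poly_Mapping.keys p \<subseteq> M"
  shows "meval h x p = (\<Sum>m\<in>M.
     h (Poly_Mapping.lookup p m) * (\<Prod>i\<in>UNIV. (x $ i) ^ Poly_Mapping.lookup m i))"
  unfolding meval_def using assms
  by (intro sum.mono_neutral_left) (auto simp: in_keys_iff unital_hom.hom_0)

lemma meval_single:
  assumes "unital_hom h"
  shows "meval h x (Poly_Mapping.single m c) = h c * (\<Prod>i\<in>UNIV. (x $ i) ^ Poly_Mapping.lookup m i)"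
  by (subst meval_superset[OF assms, of "{m}"]) auto

lemma meval_add:
  assumes "unital_hom h"
  shows "meval h x (p + q) = meval h x p + meval h x q"
proof -
  let ?M = "Poly_Mapping.keys p \<union> Poly_Mapping.keys q"
  have "Poly_Mapping.keys (p + q) \<subseteq> ?M" by (rule Poly_Mapping.keys_add)
  thus ?thesis
    by (simp add: meval_superset[OF assms, of ?M] lookup_add unital_hom.hom_add[OF assms]
        distrib_right sum.distrib)
qed

lemma poly_mapping_monomial_induct:
  fixes p :: "'m \<Rightarrow>\<^sub>0 'k::comm_monoid_add"
  assumes "\<And>m c. P (Poly_Mapping.single m c)" "\<And>p q. P p \<Longrightarrow> P q \<Longrightarrow> P (p + q)"
  shows "P p"
proof (induction p rule: update_induct)
  case const
  show ?case using assms(1)[of undefined 0] by simp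
next
  case (update f a b)
  have "Poly_Mapping.update a b f = f + Poly_Mapping.single a b"
    using update by (intro poly_mapping_eqI)
      (auto simp: lookup_update lookup_add lookup_single when_def in_keys_iff)
  thus ?case using assms update by simp
qed

lemma unital_hom_meval:
  assumes "unital_hom h"
  shows "unital_hom (meval h x)"
proof
  interpret h: unital_hom h by fact
  show "meval h x (p + q) = meval h x p + meval h x q" for p q by (rule meval_add[OF assms])
  have "meval h x (Poly_Mapping.single 0 1) = 1"
    unfolding meval_single[OF assms] by (simp add: h.homs)
  thus "meval h x 1 = 1" by simp
  have mono: "meval h x (Poly_Mapping.single m c * q) = meval h x (Poly_Mapping.single m c) * meval h x q" for m c q
    by (induction q rule: poly_mapping_monomial_induct)
      (simp_all add: mult_single meval_single[OF assms] meval_add[OF assms] h.homs lookup_add power_add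
        prod.distrib algebra_simps)
  show "meval h x (p * q) = meval h x p * meval h x q" for p q
    by (induction p rule: poly_mapping_monomial_induct)
      (simp_all add: mono meval_add[OF assms] distrib_right)
qed

text \<open>
  Substituting a point and then applying a ring homomorphism to the value is substituting the image
  point.  With point evaluation of univariate polynomials as the homomorphism, this compares
  a polynomial restricted to a line with its values at the points of the line.
\<close>
lemma hom_meval:
  assumes "unital_hom g"
  shows "g (meval h x p) = meval (\<lambda>c. g (h c)) (\<chi> i. g (x $ i)) p"
  by (simp add: meval_def unital_hom.homs[OF assms])

lemma meval_const:
  assumes "unital_hom h"
  shows "meval h x (Poly_Mapping.single 0 c) = h c"
  by (simp add: meval_single[OF assms])

lemma meval_var:
  assumes "unital_hom h"
  shows "meval h x (Poly_Mapping.single (Poly_Mapping.single i 1) 1) = x $ i"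
proof -
  have "(\<Prod>j\<in>UNIV. x $ j ^ Poly_Mapping.lookup (Poly_Mapping.single i 1) j)
      = (\<Prod>j\<in>UNIV. if j = i then x $ j else 1)"
    by (intro prod.cong) (auto simp: lookup_single when_def)
  thus ?thesis by (simp add: meval_single[OF assms] unital_hom.hom_1[OF assms])
qed

section \<open>Nonvanishing points over infinite domains\<close>

lemma poly_eq_0_if_vanishes:
  fixes p :: "'r::idom poly"
  assumes "infinite (UNIV :: 'r set)" "\<And>x. poly p x = 0"
  shows "p = 0"
  using poly_roots_finite[of p] assms by auto

text \<open>
  Distinct monomials are linearly independent as functions over an infinite domain.  The induction is
  on the set of variables: for fixed values of the other variables, the sum is a univariate polynomial
  in the new variable that vanishes everywhere, so each of its coefficients vanishes, and such a
  coefficient collects the monomials with a prescribed exponent of the new variable.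
\<close>
lemma monomials_independent:
  fixes a :: "'m \<Rightarrow> 'r::idom" and e :: "'m \<Rightarrow> 'n \<Rightarrow> nat"
  assumes inf: "infinite (UNIV :: 'r set)" and S: "finite S" and "finite M"
    and "\<And>m m'. m \<in> M \<Longrightarrow> m' \<in> M \<Longrightarrow> (\<And>i. i \<in> S \<Longrightarrow> e m i = e m' i) \<Longrightarrow> m = m'"
    and "\<And>x. (\<Sum>m\<in>M. a m * (\<Prod>i\<in>S. x i ^ e m i)) = 0"
    and "m \<in> M"
  shows "a m = 0"
  using S assms(3-)
proof (induction S arbitrary: M)
  case empty
  hence "M = {m}" by auto
  thus ?case using empty(3)[of undefined] by simp
next
  case (insert j S)
  \<comment> \<open>Only the monomials with the same exponent of \<open>j\<close> as \<open>m\<close> matter; on these, the exponents in \<open>S\<close> decide.\<close>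
  define M' where "M' = {m' \<in> M. e m' j = e m j}"
  show ?case
  proof (rule insert.IH[of M'])
    show "finite M'" "m \<in> M'" using insert.prems by (auto simp: M'_def)
    show "m1 = m2" if "m1 \<in> M'" "m2 \<in> M'" "\<And>i. i \<in> S \<Longrightarrow> e m1 i = e m2 i" for m1 m2
    proof (rule insert.prems(2))
      show "m1 \<in> M" "m2 \<in> M" using that by (auto simp: M'_def)
      show "e m1 i = e m2 i" if "i \<in> insert j S" for i
        using that \<open>m1 \<in> M'\<close> \<open>m2 \<in> M'\<close> \<open>\<And>i. i \<in> S \<Longrightarrow> e m1 i = e m2 i\<close> by (auto simp: M'_def)
    qed
    fix x :: "'n \<Rightarrow> 'r"
    define p where "p = (\<Sum>m\<in>M. Polynomial.monom (a m * (\<Prod>i\<in>S. x i ^ e m i)) (e m j))"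
    have "poly p y = 0" for y
    proof -
      have P: "(\<Prod>i\<in>S. (x(j := y)) i ^ e m i) = (\<Prod>i\<in>S. x i ^ e m i)" for m
        using insert.hyps by (intro prod.cong) auto
      have "poly p y = (\<Sum>m\<in>M. a m * (\<Prod>i\<in>insert j S. (x(j := y)) i ^ e m i))"
        using insert.hyps by (simp add: p_def poly_sum poly_monom P[unfolded fun_upd_apply] mult_ac)
      thus ?thesis using insert.prems(3)[of "x(j := y)"] by simp
    qed
    hence "Polynomial.coeff p (e m j) = 0" using poly_eq_0_if_vanishes[OF inf, of p] by simp
    moreover have "Polynomial.coeff p (e m j) = (\<Sum>m'\<in>M. if e m' j = e m j then a m' * (\<Prod>i\<in>S. x i ^ e m' i) else 0)"
      by (simp add: p_def coeff_sum)
    ultimately show "(\<Sum>m\<in>M'. a m * (\<Prod>i\<in>S. x i ^ e m i)) = 0"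
      using insert.prems(1) by (simp add: M'_def sum.If_cases Int_def)
  qed
qed

text \<open>
  This makes it possible to specialize a fraction without killing its denominator: over a finite
  field \<open>k\<close> a nonzero polynomial may vanish at all points, but not over an infinite domain above \<open>k\<close>.
\<close>
lemma exists_meval_nonzero:
  fixes q :: "('n::finite \<Rightarrow>\<^sub>0 nat) \<Rightarrow>\<^sub>0 'k::field" and h :: "'k \<Rightarrow> 'r::idom"
  assumes "infinite (UNIV :: 'r set)" "unital_hom h" "q \<noteq> 0"
  shows "\<exists>x. meval h x q \<noteq> 0"
proof (rule ccontr)
  assume "\<not> ?thesis"
  hence z: "meval h (\<chi> i. x i) q = 0" for x by blast
  obtain m where m: "m \<in> Poly_Mapping.keys q" using assms(3) keys_eq_empty by blast
  have "h (Poly_Mapping.lookup q m) = 0"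
    using z m by (intro monomials_independent[OF assms(1), of UNIV "Poly_Mapping.keys q" Poly_Mapping.lookup
        "\<lambda>m. h (Poly_Mapping.lookup q m)"])
      (auto simp: meval_def intro: poly_mapping_eqI)
  thus False using m by (simp add: unital_hom_field_eq_0_iff[OF assms(2)] in_keys_iff)
qed

lemma infinite_UNIV_poly: "infinite (UNIV :: 'a::comm_ring_1 poly set)"
proof
  assume "finite (UNIV :: 'a poly set)"
  hence "finite (range (\<lambda>n. Polynomial.monom (1::'a) n))" by (rule rev_finite_subset) auto
  moreover have "inj (\<lambda>n. Polynomial.monom (1::'a) n)" by (auto simp: inj_on_def monom_eq_iff')
  ultimately show False using finite_imageD by blast
qed

text \<open>
  Over a finite field, the product of all \<open>t - x\<close> plus \<open>1\<close> has no root.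
\<close>
lemma infinite_UNIV_alg_closed: "infinite (UNIV :: 'a::alg_closed_field set)"
proof
  assume fin: "finite (UNIV :: 'a set)"
  define p :: "'a poly" where "p = (\<Prod>x\<in>UNIV. [:- x, 1:])"
  have "Polynomial.degree p = card (UNIV :: 'a set)"
    unfolding p_def by (subst degree_prod_eq_sum_degree) auto
  hence "Polynomial.degree p > 0" using fin by (simp add: card_gt_0_iff)
  hence "Polynomial.degree (p + 1) > 0" by (subst degree_add_eq_left) auto
  then obtain x where "poly (p + 1) x = 0" using alg_closed_imp_poly_has_root by blast
  moreover have "poly p x = 0" using fin by (auto simp: p_def poly_prod prod_zero_iff)
  ultimately show False by simp
qed

section \<open>Trilinear forms given by arrays\<close>

text \<open>
  Forms are encoded by their coefficient arrays, so that extension of scalars only maps the entries.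
\<close>
definition tri :: "('n::finite \<Rightarrow> 'n \<Rightarrow> 'n \<Rightarrow> 'r::comm_ring_1) \<Rightarrow> 'r ^ 'n \<Rightarrow> 'r ^ 'n \<Rightarrow> 'r ^ 'n \<Rightarrow> 'r" where
  "tri c u v w = (\<Sum>i\<in>UNIV. \<Sum>j\<in>UNIV. \<Sum>l\<in>UNIV. c i j l * u $ i * v $ j * w $ l)"

lemma tri_add:
  "tri c (u + u') v w = tri c u v w + tri c u' v w"
  "tri c u (v + v') w = tri c u v w + tri c u v' w"
  "tri c u v (w + w') = tri c u v w + tri c u v w'"
  by (simp_all add: tri_def algebra_simps sum.distrib)

lemma tri_scale:
  "tri c (r *s u) v w = r * tri c u v w"
  "tri c u (r *s v) w = r * tri c u v w"
  "tri c u v (r *s w) = r * tri c u v w"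
  by (simp_all add: tri_def algebra_simps sum_distrib_left)

lemma tri_zero:
  "tri c 0 v w = 0" "tri c u 0 w = 0" "tri c u v 0 = 0"
  by (simp_all add: tri_def)

lemma tri_sum:
  "tri c (sum f A) v w = (\<Sum>a\<in>A. tri c (f a) v w)"
  "tri c u (sum f A) w = (\<Sum>a\<in>A. tri c u (f a) w)"
  "tri c u v (sum f A) = (\<Sum>a\<in>A. tri c u v (f a))"
  by (induction A rule: infinite_finite_induct; simp add: tri_zero tri_add)+

text \<open>
  Change of variables: pulling a form back along \<open>P\<close> gives the form whose array consists of the
  values on the columns of \<open>P\<close>.  Identities of arrays and identities of forms are exchanged through
  this rule.
\<close>
lemma tri_matrix_vector:
  assumes "\<And>i j l. tri c (column i P) (column j P) (column l P) = d i j l"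
  shows "tri c (P *v u) (P *v v) (P *v w) = tri d u v w"
proof -
  have 1: "tri c (P *v u) y z = (\<Sum>i\<in>UNIV. u $ i * tri c (column i P) y z)" for y z
    by (simp add: matrix_mult_sum tri_sum tri_scale)
  have 2: "tri c x (P *v v) z = (\<Sum>j\<in>UNIV. v $ j * tri c x (column j P) z)" for x z
    by (simp add: matrix_mult_sum tri_sum tri_scale)
  have 3: "tri c x y (P *v w) = (\<Sum>l\<in>UNIV. w $ l * tri c x y (column l P))" for x y
    by (simp add: matrix_mult_sum tri_sum tri_scale)
  have "tri c (P *v u) (P *v v) (P *v w) =
      (\<Sum>i\<in>UNIV. u $ i * (\<Sum>j\<in>UNIV. v $ j * (\<Sum>l\<in>UNIV. w $ l * d i j l)))"
    unfolding 1 unfolding 2 unfolding 3 unfolding assms ..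
  thus ?thesis by (simp add: tri_def sum_distrib_left mult_ac)
qed

lemma sum_if_const: "(\<Sum>t\<in>A. if P then f t else 0) = (if P then sum f A else (0::'a::comm_monoid_add))"
  by simp

lemma tri_axis: "tri c (axis i 1) (axis j 1) (axis l 1) = c i j l"
proof -
  have "c i' j' l' * axis i 1 $ i' * axis j 1 $ j' * axis l 1 $ l' =
    (if i' = i then if j' = j then if l' = l then c i j l else 0 else 0 else 0)" for i' j' l'
    by (simp add: axis_def)
  thus ?thesis by (simp add: tri_def sum_if_const)
qed

lemma tri_array_scale: "tri (\<lambda>i j l. g * c i j l) u v w = g * tri c u v w"
  by (simp add: tri_def sum_distrib_left mult_ac)

lemma hom_tri:
  assumes "unital_hom h"
  shows "h (tri c u v w) = tri (\<lambda>i j l. h (c i j l)) (\<chi> i. h (u $ i)) (\<chi> i. h (v $ i)) (\<chi> i. h (w $ i))"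
  by (simp add: tri_def unital_hom.homs[OF assms])

definition diag_array :: "('n \<Rightarrow> 'r::zero) \<Rightarrow> 'n \<Rightarrow> 'n \<Rightarrow> 'n \<Rightarrow> 'r" where
  "diag_array a i j l = (if i = j \<and> j = l then a i else 0)"

lemma tri_diag_array:
  "tri (diag_array a) u v w = (\<Sum>m\<in>UNIV. a m * u $ m * v $ m * w $ m)"
proof -
  have "diag_array a i j l * u $ i * v $ j * w $ l =
    (if j = i then if l = j then a i * u $ i * v $ j * w $ l else 0 else 0)" for i j l
    by (simp add: diag_array_def)
  thus ?thesis by (simp add: tri_def sum_if_const)
qed

lemma diag_form_eq_tri: "diag_form a x = tri (diag_array a) x x x"
  by (simp add: tri_diag_array diag_form_def power3_eq_cube mult_ac)

lemma hom_diag_array: "h 0 = 0 \<Longrightarrow> h (diag_array a i j l) = diag_array (\<lambda>m. h (a m)) i j l"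
  by (simp add: diag_array_def)

lemma symmetric3_diag_array: "symmetric3 (diag_array a)"
  by (auto simp: symmetric3_def diag_array_def)

lemma symmetric3_tri:
  assumes "symmetric3 c"
  shows "tri c u v w = tri c v u w" "tri c u v w = tri c u w v"
proof -
  have s: "c i j l = c j i l" "c i j l = c i l j" for i j l
    using assms by (auto simp: symmetric3_def)
  show "tri c u v w = tri c v u w"
    unfolding tri_def
    by (subst sum.swap, intro sum.cong refl, subst s(1)) (simp add: ac_simps)
  show "tri c u v w = tri c u w v"
    unfolding tri_def
    by (rule sum.cong[OF refl], subst sum.swap, intro sum.cong refl, subst s(2)) (simp add: ac_simps)
qed

lemma trilinear_tri:
  fixes scl :: "'k::field \<Rightarrow> 'v::ab_group_add \<Rightarrow> 'v"
  assumes f: "Vector_Spaces.linear scl (*s) f"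
  shows "trilinear scl (\<lambda>u v w. tri c (f u) (f v) (f w))"
proof -
  interpret f: Vector_Spaces.linear scl "(*s)" f by fact
  have vk: "vector_space ((*) :: 'k \<Rightarrow> 'k \<Rightarrow> 'k)" by unfold_locales (auto simp: algebra_simps)
  show ?thesis
    unfolding trilinear_def Vector_Spaces.linear_def module_hom_def module_hom_axioms_def
    using f.vs1.vector_space_axioms vk module_iff_vector_space[of scl] module_iff_vector_space[of "(*) :: 'k \<Rightarrow> 'k \<Rightarrow> 'k"]
    by (simp add: f.add f.scale tri_add tri_scale)
qed

text \<open>
  Since 6 is invertible, a symmetric trilinear form can be recovered from its cubic form; hence an
  identity of cubic forms after linear substitutions is an identity of trilinear forms.
\<close>
lemma tri_polarization:
  fixes scl :: "'k::field \<Rightarrow> 'v::ab_group_add \<Rightarrow> 'v"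
  assumes "(6::'k) \<noteq> 0" "symmetric3 c" "symmetric3 d"
    and "Vector_Spaces.linear scl (*s) f" "Vector_Spaces.linear scl (*s) g"
    and "\<And>v. tri c (f v) (f v) (f v) = tri d (g v) (g v) (g v)"
  shows "tri c (f u) (f v) (f w) = tri d (g u) (g v) (g w)"
proof -
  have s: "symmetric3 (\<lambda>u v w. tri c (f u) (f v) (f w))" "symmetric3 (\<lambda>u v w. tri d (g u) (g v) (g w))"
    using symmetric3_tri[OF assms(2)] symmetric3_tri[OF assms(3)] unfolding symmetric3_def by blast+
  note P = polar_form_eqI[of scl _ "\<lambda>v. tri c (f v) (f v) (f v)", OF assms(1)]
  have "(\<lambda>u v w. tri c (f u) (f v) (f w)) = (\<lambda>u v w. tri d (g u) (g v) (g w))"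
    by (rule trans[OF sym[OF P] P]) (intro trilinear_tri s assms refl)+
  from fun_cong[OF fun_cong[OF fun_cong[OF this]]] show ?thesis .
qed

section \<open>Nondegeneracy and diagonalization\<close>

text \<open>
  Nondegeneracy says that a linear system over \<open>k\<close> has no nontrivial solution.  A left inverse of its
  matrix is a witness of this which, unlike the statement about solutions, carries over to every
  extension field by mapping the entries.
\<close>
lemma tri_left_inverse:
  fixes c :: "'n::finite \<Rightarrow> 'n \<Rightarrow> 'n \<Rightarrow> 'k::field"
  assumes "\<And>x. (\<And>v w. tri c x v w = 0) \<Longrightarrow> x = 0"
  shows "\<exists>N :: 'n \<Rightarrow> 'n \<times> 'n \<Rightarrow> 'k. \<forall>i' i. (\<Sum>p\<in>UNIV. N i' p * c i (fst p) (snd p)) = of_bool (i' = i)"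
proof -
  define M :: "'k ^ 'n ^ ('n \<times> 'n)" where "M = (\<chi> p i. c i (fst p) (snd p))"
  have "x = 0" if "M *v x = 0" for x
  proof (rule assms)
    fix v w
    have z: "(\<Sum>i\<in>UNIV. c i j l * x $ i) = 0" for j l
      using arg_cong[OF that, of "\<lambda>y. y $ (j, l)"] by (simp add: M_def matrix_vector_mult_def)
    have "tri c x v w = (\<Sum>j\<in>UNIV. \<Sum>i\<in>UNIV. \<Sum>l\<in>UNIV. c i j l * x $ i * v $ j * w $ l)"
      unfolding tri_def by (rule sum.swap)
    also have "\<dots> = (\<Sum>j\<in>UNIV. \<Sum>l\<in>UNIV. (\<Sum>i\<in>UNIV. c i j l * x $ i) * v $ j * w $ l)"
      unfolding sum_distrib_right by (intro sum.cong refl sum.swap)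
    finally have "tri c x v w =
        (\<Sum>j\<in>UNIV. \<Sum>l\<in>UNIV. (\<Sum>i\<in>UNIV. c i j l * x $ i) * v $ j * w $ l)" .
    thus "tri c x v w = 0" by (simp add: z)
  qed
  hence "\<exists>N. N ** M = mat 1" unfolding matrix_left_invertible_ker by (intro allI impI)
  then obtain N where N: "N ** M = mat 1" ..
  have "(\<Sum>p\<in>UNIV. N $ i' $ p * c i (fst p) (snd p)) = of_bool (i' = i)" for i' i
    using arg_cong[OF N, of "\<lambda>A. A $ i' $ i"]
    by (simp add: matrix_matrix_mult_def M_def mat_def of_bool_def)
  thus ?thesis by (intro exI[of _ "\<lambda>i p. N $ i $ p"]) blast
qed

text \<open>
  A diagonalization over an extension field is nondegenerate because the left inverse of the previous
  lemma can be extended.  Substituting the diagonal expression into it exhibits a left inverse of \<open>F\<close>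
  in which the column with index \<open>m\<close> has the factor \<open>a m\<close>, so that no \<open>a m\<close> can vanish.
\<close>
lemma diagonalizing_matrix_invertible:
  fixes c :: "'n::finite \<Rightarrow> 'n \<Rightarrow> 'n \<Rightarrow> 'k::field" and h :: "'k \<Rightarrow> 'l::field"
    and F :: "'l ^ 'n ^ 'n"
  assumes h: "unital_hom h"
    and nondeg: "\<And>x. (\<And>v w. tri c x v w = 0) \<Longrightarrow> x = 0"
    and F: "\<And>i j l. h (c i j l) = tri (diag_array a) (column i F) (column j F) (column l F)"
  shows "\<exists>G. F ** G = mat 1" and "a m \<noteq> 0"
proof -
  interpret unital_hom h by fact
  obtain N :: "'n \<Rightarrow> 'n \<times> 'n \<Rightarrow> 'k"
    where N: "\<And>i' i. (\<Sum>p\<in>UNIV. N i' p * c i (fst p) (snd p)) = of_bool (i' = i)"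
    using tri_left_inverse[of c, OF nondeg] by blast
  define G :: "'l ^ 'n ^ 'n" where
    "G = (\<chi> i m. (\<Sum>p\<in>UNIV. h (N i p) * F $ m $ fst p * F $ m $ snd p) * a m)"
  have "(G ** F) $ i' $ i = of_bool (i' = i)" for i' i
  proof -
    have "of_bool (i' = i) = h (\<Sum>p\<in>UNIV. N i' p * c i (fst p) (snd p))"
      by (simp add: N of_bool_def homs)
    also have "\<dots> = (\<Sum>p\<in>UNIV. \<Sum>m\<in>UNIV. h (N i' p) * (a m * F $ m $ i * F $ m $ fst p * F $ m $ snd p))"
      by (simp add: homs F tri_diag_array column_def sum_distrib_left)
    also have "\<dots> = (\<Sum>m\<in>UNIV. \<Sum>p\<in>UNIV. h (N i' p) * (a m * F $ m $ i * F $ m $ fst p * F $ m $ snd p))"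
      by (rule sum.swap)
    also have "\<dots> = (G ** F) $ i' $ i"
      by (simp add: matrix_matrix_mult_def G_def sum_distrib_left sum_distrib_right mult_ac)
    finally show ?thesis by simp
  qed
  hence "G ** F = mat 1" by (simp add: vec_eq_iff mat_def of_bool_def)
  hence FG: "F ** G = mat 1" by (simp add: matrix_left_right_inverse)
  thus "\<exists>G. F ** G = mat 1" ..
  show "a m \<noteq> 0"
  proof
    assume "a m = 0"
    hence "(F ** G) $ m $ m = 0" by (simp add: matrix_matrix_mult_def G_def)
    thus False by (simp add: FG mat_def)
  qed
qed

section \<open>Similitudes of diagonal forms\<close>

text \<open>
  Similitudes of a nondegenerate diagonal cubic form are monomial matrices.  Fix two different columns
  \<open>i\<close> and \<open>j\<close>.  The vector with components \<open>a m * C $ m $ i * C $ m $ j\<close> is orthogonal to every column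
  of \<open>C\<close>, and \<open>C\<close> is invertible, so this vector is zero: each row of \<open>C\<close> has at most one nonzero entry.
\<close>
lemma rows_of_diagonal_similitude:
  fixes C :: "'r::field ^ 'n ^ 'n"
  assumes a: "\<And>m. a m \<noteq> 0" and g: "g \<noteq> 0"
    and C: "\<And>i j l. tri (diag_array a) (column i C) (column j C) (column l C) = g * diag_array a i j l"
    and "i \<noteq> j"
  shows "C $ m $ i * C $ m $ j = 0"
proof -
  \<comment> \<open>The similitude relation with two equal indices exhibits an inverse of \<open>C\<close>.\<close>
  define L :: "'r ^ 'n ^ 'n" where "L = (\<chi> i m. a m * C $ m $ i * C $ m $ i / (g * a i))"
  have "(L ** C) $ i $ l = mat 1 $ i $ l" for i l
    using C[of i i l] a g
    by (simp add: matrix_matrix_mult_def L_def tri_diag_array column_def mat_def diag_array_def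
        flip: sum_divide_distrib)
  hence "L ** C = mat 1" by (simp add: vec_eq_iff)
  hence LC: "C ** L = mat 1" by (simp add: matrix_left_right_inverse)
  define z :: "'r ^ 'n" where "z = (\<chi> m. a m * C $ m $ i * C $ m $ j)"
  have "z v* C = 0"
    using C[of i j] \<open>i \<noteq> j\<close>
    by (simp add: vec_eq_iff vector_matrix_mult_def z_def tri_diag_array column_def diag_array_def mult_ac)
  hence "z v* (C ** L) = 0" by (simp flip: vector_matrix_mul_assoc)
  hence "z $ m = 0" by (simp add: LC)
  thus ?thesis using a[of m] by (simp add: z_def)
qed

lemma Fract_eq_0_iff: "Fract p 1 = 0 \<longleftrightarrow> p = (0::'a::idom)"
  by (simp add: Zero_fract_def eq_fract)

text \<open>
  The same over a domain, by passing to its field of fractions; it is needed over a univariate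
  polynomial ring.
\<close>
lemma rows_of_diagonal_similitude_idom:
  fixes C :: "'r::idom ^ 'n ^ 'n"
  assumes a: "\<And>m. a m \<noteq> 0" and g: "g \<noteq> 0"
    and C: "\<And>i j l. tri (diag_array a) (column i C) (column j C) (column l C) = g * diag_array a i j l"
    and "i \<noteq> j"
  shows "C $ m $ i * C $ m $ j = 0"
proof -
  define e :: "'r \<Rightarrow> 'r fract" where "e = (\<lambda>p. Fract p 1)"
  have e: "unital_hom e" unfolding e_def by (rule unital_hom_Fract)
  have e0: "e p = 0 \<longleftrightarrow> p = 0" for p by (simp add: e_def Fract_eq_0_iff)
  define C' where "C' = (\<chi> m i. e (C $ m $ i))"
  have col: "column i C' = (\<chi> m. e (column i C $ m))" for i
    by (simp add: column_def C'_def)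
  have "C' $ m $ i * C' $ m $ j = 0"
  proof (rule rows_of_diagonal_similitude[of "\<lambda>m. e (a m)" "e g"])
    show "tri (diag_array (\<lambda>m. e (a m))) (column i C') (column j C') (column l C')
        = e g * diag_array (\<lambda>m. e (a m)) i j l" for i j l
      using arg_cong[OF C, of e]
      by (simp add: hom_tri[OF e] hom_diag_array e0 unital_hom.hom_mult[OF e] col)
  qed (use a g \<open>i \<noteq> j\<close> in \<open>auto simp: e0\<close>)
  thus ?thesis by (simp add: C'_def e0 flip: unital_hom.hom_mult[OF e])
qed

text \<open>
  As each row has at most one nonzero entry and each column at least one, by the similitude relation,
  each column has exactly one.  The relation for a column then has a single summand, which makes the
  factor a cube up to constants.
\<close>
lemma diagonal_similitude_factor:
  fixes C :: "'r::idom ^ 'n ^ 'n"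
  assumes a: "\<And>m. a m \<noteq> 0" and g: "g \<noteq> 0"
    and C: "\<And>i j l. tri (diag_array a) (column i C) (column j C) (column l C) = g * diag_array a i j l"
  shows "\<exists>m. g * a i = a m * C $ m $ i ^ 3"
proof -
  have row: "i = j" if "C $ m $ i \<noteq> 0" "C $ m $ j \<noteq> 0" for m i j
    using rows_of_diagonal_similitude_idom[OF assms, of i j m] that by auto
  have cube: "g * a i = (\<Sum>m\<in>UNIV. a m * C $ m $ i ^ 3)" for i
    using C[of i i i] by (simp add: tri_diag_array diag_array_def column_def power3_eq_cube mult_ac)
  have "\<exists>m. C $ m $ i \<noteq> 0" for i
  proof (rule ccontr)
    assume "\<not> ?thesis"
    hence "g * a i = 0" by (simp add: cube)
    thus False using a g by simp
  qed
  then obtain s where s: "\<And>i. C $ s i $ i \<noteq> 0" by metis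
  \<comment> \<open>Choosing a nonzero entry in every column is injective because of the rows, hence surjective.\<close>
  have "inj s" using row s by (metis injI)
  hence "surj s" by (simp add: finite_UNIV_inj_surj)
  have "m = s i" if "C $ m $ i \<noteq> 0" for m
    using that row s \<open>surj s\<close> by (metis surj_def)
  hence "a m * C $ m $ i ^ 3 = (if m = s i then a m * C $ m $ i ^ 3 else 0)" for m
    by auto
  hence "g * a i = (\<Sum>m\<in>UNIV. if m = s i then a m * C $ m $ i ^ 3 else 0)"
    unfolding cube by (rule sum.cong[OF refl])
  thus ?thesis by (intro exI[of _ "s i"]) simp
qed

section \<open>Specialization to a line\<close>

lemma order_cube:
  fixes p :: "'a::idom poly"
  shows "p \<noteq> 0 \<Longrightarrow> Polynomial.order r (p ^ 3) = 3 * Polynomial.order r p"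
  by (simp add: power3_eq_cube order_mult)

text \<open>
  The derivative \<open>3 a (t + y)^2\<close> vanishes only at \<open>t = -y\<close>, where the polynomial has the value \<open>c0\<close>.
\<close>
lemma simple_root_of_shifted_cube:
  fixes c0 a y :: "'l::alg_closed_field"
  assumes "(3::'l) \<noteq> 0" "c0 \<noteq> 0" "a \<noteq> 0"
  defines "p \<equiv> [:c0:] + Polynomial.smult a ([:y, 1:] ^ 3)"
  shows "\<exists>r. Polynomial.order r p = 1" and "p \<noteq> 0"
proof -
  have "Polynomial.degree ([:y, 1:] ^ 3) = 3" by (simp add: degree_power_eq)
  hence "Polynomial.degree p = 3"
    unfolding p_def using assms by (subst degree_add_eq_right) auto
  thus "p \<noteq> 0" by auto
  obtain r where r: "poly p r = 0" using alg_closed_imp_poly_has_root[of p] \<open>Polynomial.degree p = 3\<close> by auto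
  hence "r + y \<noteq> 0" using assms by (auto simp: p_def add.commute)
  have "\<not> 2 \<le> Polynomial.order r p"
  proof
    assume "2 \<le> Polynomial.order r p"
    hence "[:-r, 1:] ^ 2 dvd p" by (simp add: order_divides)
    then obtain q where "p = [:-r, 1:] ^ 2 * q" by (auto elim: dvdE)
    hence "poly (pderiv p) r = 0" by (simp add: pderiv_mult pderiv_power)
    moreover have "poly (pderiv p) r = a * (3 * (r + y) ^ 2)"
      by (simp add: p_def pderiv_add pderiv_smult pderiv_power pderiv_pCons algebra_simps)
    ultimately show False using \<open>r + y \<noteq> 0\<close> assms by simp
  qed
  moreover have "Polynomial.order r p \<noteq> 0" using r \<open>p \<noteq> 0\<close> order_root by blast
  ultimately show "\<exists>r. Polynomial.order r p = 1" by (intro exI[of _ r]) linarith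
qed

lemma hom_matrix_mult_one:
  assumes "unital_hom h" "F ** G = mat 1"
  shows "(\<chi> i j. h (F $ i $ j)) ** (\<chi> i j. h (G $ i $ j)) = mat 1"
proof -
  have "(\<Sum>k\<in>UNIV. h (F $ i $ k) * h (G $ k $ j)) = h ((F ** G) $ i $ j)" for i j
    by (simp add: matrix_matrix_mult_def unital_hom.homs[OF assms(1)])
  hence "(\<Sum>k\<in>UNIV. h (F $ i $ k) * h (G $ k $ j)) = (if i = j then 1 else 0)" for i j
    by (simp add: assms(2) mat_def unital_hom.homs[OF assms(1)])
  thus ?thesis by (simp add: vec_eq_iff matrix_matrix_mult_def mat_def)
qed

lemma matrix_vector_axis:
  fixes A :: "'r::comm_ring_1 ^ 'n ^ 'm"
  shows "A *v axis i 1 = column i A"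
  by (simp add: vec_eq_iff matrix_vector_mult_def column_def axis_def if_distrib[of "(*) _"] cong: if_cong)

text \<open>
  A similitude \<open>P\<close> of a form becomes the similitude \<open>F P G\<close> of the diagonal form in the coordinates
  given by \<open>F\<close>.
\<close>
lemma tri_conjugate_similitude:
  assumes F: "\<And>i j l. c i j l = tri (diag_array a) (column i F) (column j F) (column l F)"
    and P: "\<And>i j l. tri c (column i P) (column j P) (column l P) = g * c i j l"
    and FG: "F ** G = mat 1"
  defines "C \<equiv> F ** (P ** G)"
  shows "tri (diag_array a) (column i C) (column j C) (column l C) = g * diag_array a i j l"
proof -
  have D: "tri (diag_array a) (F *v u) (F *v v) (F *v w) = tri c u v w" for u v w
    by (rule tri_matrix_vector) (simp add: F)
  have col: "column i C = F *v (P *v (G *v axis i 1))" for i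
    by (simp add: C_def matrix_vector_mul_assoc matrix_mul_assoc flip: matrix_vector_axis)
  have ax: "F *v (G *v axis i 1) = axis i 1" for i
    by (simp add: matrix_vector_mul_assoc FG)
  have "tri (diag_array a) (column i C) (column j C) (column l C)
      = tri (\<lambda>i j l. g * c i j l) (G *v axis i 1) (G *v axis j 1) (G *v axis l 1)"
    unfolding col D by (rule tri_matrix_vector) (rule P)
  also have "\<dots> = g * diag_array a i j l"
    unfolding tri_array_scale by (simp flip: D add: ax tri_axis)
  finally show ?thesis .
qed

lemma diag_array_split:
  "tri (diag_array a) y y y = a e * y $ e ^ 3 + (\<Sum>m\<in>UNIV - {e}. a m * y $ m ^ 3)"
  by (simp add: tri_diag_array power3_eq_cube mult_ac sum.remove[of UNIV e])

lemma sum_linear_polys: "(\<Sum>i\<in>A. [:f i, g i:]) = [:sum f A, sum g A:]"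
  by (induction A rule: infinite_finite_induct) auto

text \<open>
  The heart of the argument.  Here \<open>gen\<close> is the generic vector, \<open>\<Phi>\<close> the generic value of the form,
  and \<open>P / q\<close> a similitude over \<open>k(X)\<close> with factor \<open>\<Phi>^2\<close>, so that \<open>P\<close> has the factor \<open>q^3 \<Phi>^2\<close>.
  Suppose that there are two different indices \<open>e\<close> and \<open>e'\<close> of diagonal coordinates.  The variables are replaced by a line
  in the direction of the coordinate \<open>e\<close> over the algebraically closed field.  If \<open>q\<close> does not vanish
  identically on the line, then \<open>q^3 \<Phi>^2\<close> is the factor of a similitude of a diagonal form over
  polynomials in \<open>t\<close>, hence a constant times a cube.  On the line \<open>\<Phi>\<close> is \<open>c0 + a e * (y + t)^3\<close>, where
  \<open>c0\<close> is the contribution of the other coordinates.  If \<open>c0\<close> is not zero, then this has a simple root,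
  at which \<open>q^3 \<Phi>^2\<close> has an order congruent to 2 modulo 3: a contradiction.
\<close>
lemma dimension_one_if_similitude:
  fixes c :: "'n::finite \<Rightarrow> 'n \<Rightarrow> 'n \<Rightarrow> 'k::field" and h :: "'k \<Rightarrow> 'l::alg_closed_field"
    and F G :: "'l ^ 'n ^ 'n" and P :: "(('n \<Rightarrow>\<^sub>0 nat) \<Rightarrow>\<^sub>0 'k) ^ 'n ^ 'n"
    and gen :: "(('n \<Rightarrow>\<^sub>0 nat) \<Rightarrow>\<^sub>0 'k) ^ 'n"
  assumes three: "(3::'l) \<noteq> 0" and h: "unital_hom h"
    and F: "\<And>i j l. h (c i j l) = tri (diag_array a) (column i F) (column j F) (column l F)"
    and FG: "F ** G = mat 1" and a: "\<And>m. a m \<noteq> 0"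
    and gen: "gen = (\<chi> i. Poly_Mapping.single (Poly_Mapping.single i 1) 1)"
    and \<Phi>: "\<Phi> = tri (\<lambda>i j l. Poly_Mapping.single 0 (c i j l)) gen gen gen"
    and q: "q \<noteq> 0"
    and P: "\<And>i j l. tri (\<lambda>i j l. Poly_Mapping.single 0 (c i j l)) (column i P) (column j P) (column l P)
      = q ^ 3 * \<Phi> ^ 2 * Poly_Mapping.single 0 (c i j l)"
  shows "CARD('n) = 1"
proof (rule ccontr)
  assume "CARD('n) \<noteq> 1"
  then obtain e e' :: 'n where ee': "e \<noteq> e'"
    by (metis (full_types) One_nat_def UNIV_eq_I card_1_singleton_iff insertI1)
  define k :: "'l \<Rightarrow> 'l poly" where "k = (\<lambda>c. [:c:])"
  have k: "unital_hom k" unfolding k_def by (rule unital_hom_const_poly)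
  have k0: "k x = 0 \<longleftrightarrow> x = 0" for x by (simp add: k_def)
  have H: "unital_hom (\<lambda>c. k (h c))" by (rule unital_hom_compose[OF h k])
  define line :: "'l ^ 'n \<Rightarrow> 'l ^ 'n \<Rightarrow> 'l poly ^ 'n" where "line w v = (\<chi> i. [:w $ i, v $ i:])" for w v
  have point: "poly (meval (\<lambda>c. k (h c)) (line w v) p) s = meval h (w + s *s v) p" for w v s p
  proof -
    have "w + s *s v = (\<chi> i. w $ i + s * v $ i)" by (simp add: vec_eq_iff)
    thus ?thesis by (simp add: hom_meval[OF unital_hom_poly] line_def k_def)
  qed
  have FGe: "F *v column i G = axis i 1" for i
    using FG by (simp add: matrix_mult_dot vec_eq_iff column_def matrix_matrix_mult_def matrix_vector_mult_def mat_def axis_def)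

  \<comment> \<open>The base point \<open>w\<close> of the line must satisfy \<open>q(w) \<noteq> 0\<close> and \<open>c0 \<noteq> 0\<close>.  Start from \<open>w0\<close> with \<open>q(w0) \<noteq> 0\<close> and
      move it by \<open>s\<close> in the direction of the second coordinate \<open>e'\<close>: then \<open>q\<close> and \<open>c0\<close> become nonzero
      polynomials in \<open>s\<close>, the latter being \<open>\<kappa>\<close>, and some \<open>s0\<close> is a root of neither.\<close>
  obtain w0 where w0: "meval h w0 q \<noteq> 0"
    using exists_meval_nonzero[OF infinite_UNIV_alg_closed h q] by blast
  define y0 where "y0 = F *v w0"
  define \<kappa> where "\<kappa> = [:\<Sum>m\<in>UNIV - {e} - {e'}. a m * y0 $ m ^ 3:] + Polynomial.smult (a e') ([:y0 $ e', 1:] ^ 3)"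
  have "Polynomial.degree ([:y0 $ e', 1:] ^ 3) = 3" by (simp add: degree_power_eq)
  hence "Polynomial.degree \<kappa> = 3"
    unfolding \<kappa>_def using a by (subst degree_add_eq_right) auto
  hence "\<kappa> \<noteq> 0" by auto
  moreover have "meval (\<lambda>c. k (h c)) (line w0 (column e' G)) q \<noteq> 0"
    using point[of w0 "column e' G" q 0] w0 by auto
  ultimately have "\<kappa> * meval (\<lambda>c. k (h c)) (line w0 (column e' G)) q \<noteq> 0" by simp
  then obtain s0 where s0: "poly (\<kappa> * meval (\<lambda>c. k (h c)) (line w0 (column e' G)) q) s0 \<noteq> 0"
    using poly_eq_0_if_vanishes[OF infinite_UNIV_alg_closed] by blast
  define w where "w = w0 + s0 *s column e' G"
  define c0 where "c0 = (\<Sum>m\<in>UNIV - {e}. a m * (F *v w) $ m ^ 3)"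
  have Fw: "F *v w = y0 + s0 *s axis e' 1"
    by (simp add: w_def y0_def FGe matrix_vector_right_distrib vector_scalar_commute)
  have "c0 = (\<Sum>m\<in>UNIV - {e} - {e'}. a m * y0 $ m ^ 3) + a e' * (y0 $ e' + s0) ^ 3"
    unfolding c0_def using ee' by (subst sum.remove[of _ e']) (auto simp: Fw axis_def)
  hence "c0 = poly \<kappa> s0" by (simp add: \<kappa>_def add.commute)
  hence c0: "c0 \<noteq> 0" and qw: "meval h w q \<noteq> 0"
    using s0 by (auto simp: point w_def)

  \<comment> \<open>Specialization of the whole situation to the line through \<open>w\<close> in direction \<open>e\<close>.\<close>
  define x where "x = line w (column e G)"
  define ev where "ev = meval (\<lambda>c. k (h c)) x"
  have ev: "unital_hom ev" unfolding ev_def by (rule unital_hom_meval[OF H])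
  have ev_const: "ev (Poly_Mapping.single 0 b) = k (h b)" for b
    by (simp add: ev_def meval_const[OF H])
  have ev_gen: "(\<chi> i. ev (gen $ i)) = x"
    using meval_var[OF H, of x] by (simp add: ev_def gen vec_eq_iff)
  define F' where "F' = (\<chi> i j. k (F $ i $ j))"
  define G' where "G' = (\<chi> i j. k (G $ i $ j))"
  define P' where "P' = (\<chi> i j. ev (P $ i $ j))"
  have F'G': "F' ** G' = mat 1" unfolding F'_def G'_def by (rule hom_matrix_mult_one[OF k FG])
  have colF': "column i F' = (\<chi> m. k (column i F $ m))" for i by (simp add: F'_def column_def)
  have colP': "column i P' = (\<chi> m. ev (column i P $ m))" for i by (simp add: P'_def column_def)
  have F'eq: "k (h (c i j l)) = tri (diag_array (\<lambda>m. k (a m))) (column i F') (column j F') (column l F')" for i j l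
    by (simp add: F hom_tri[OF k] hom_diag_array k0 colF')

  have F'x: "(F' *v x) $ m = [:(F *v w) $ m, axis e 1 $ m:]" for m
  proof -
    have "(F' *v x) $ m = (\<Sum>i\<in>UNIV. [:F $ m $ i * w $ i, F $ m $ i * column e G $ i:])"
      by (simp add: matrix_vector_mult_def F'_def x_def line_def k_def mult_ac)
    also have "\<dots> = [:(F *v w) $ m, (F *v column e G) $ m:]"
      by (simp add: matrix_vector_mult_def sum_linear_polys)
    finally show ?thesis by (simp add: FGe)
  qed
  have "ev \<Phi> = tri (\<lambda>i j l. k (h (c i j l))) x x x"
    by (simp add: \<Phi> hom_tri[OF ev] ev_const ev_gen)
  also have "\<dots> = tri (diag_array (\<lambda>m. k (a m))) (F' *v x) (F' *v x) (F' *v x)"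
    by (rule tri_matrix_vector[symmetric]) (simp add: F'eq)
  also have "\<dots> = k (a e) * (F' *v x) $ e ^ 3 + (\<Sum>m\<in>UNIV - {e}. k (a m) * (F' *v x) $ m ^ 3)"
    by (rule diag_array_split)
  also have "(\<Sum>m\<in>UNIV - {e}. k (a m) * (F' *v x) $ m ^ 3) = (\<Sum>m\<in>UNIV - {e}. k (a m * (F *v w) $ m ^ 3))"
  proof (rule sum.cong[OF refl])
    fix m assume "m \<in> UNIV - {e}"
    hence "(F' *v x) $ m = k ((F *v w) $ m)" by (simp add: F'x axis_def k_def)
    thus "k (a m) * (F' *v x) $ m ^ 3 = k (a m * (F *v w) $ m ^ 3)"
      by (simp add: unital_hom.homs[OF k])
  qed
  also have "\<dots> = k c0" by (simp add: c0_def unital_hom.homs[OF k])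
  also have "k (a e) * (F' *v x) $ e ^ 3 = Polynomial.smult (a e) ([:(F *v w) $ e, 1:] ^ 3)"
    by (simp add: F'x k_def)
  finally have \<Phi>_line: "ev \<Phi> = [:c0:] + Polynomial.smult (a e) ([:(F *v w) $ e, 1:] ^ 3)"
    by (simp add: k_def add.commute)

  \<comment> \<open>The specialized factor \<open>g\<close>, whose order at a simple root \<open>r\<close> of the specialized form is computed in two ways.\<close>
  define g where "g = ev q ^ 3 * ev \<Phi> ^ 2"
  obtain r where r: "Polynomial.order r (ev \<Phi>) = 1"
    using simple_root_of_shifted_cube(1)[OF three c0 a] unfolding \<Phi>_line by blast
  have \<Phi>0: "ev \<Phi> \<noteq> 0"
    using simple_root_of_shifted_cube(2)[OF three c0 a] unfolding \<Phi>_line .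
  have "poly (ev q) 0 \<noteq> 0" using qw point[of w "column e G" q 0] by (simp add: ev_def x_def)
  hence q0: "ev q \<noteq> 0" by auto
  hence g0: "g \<noteq> 0" using \<Phi>0 by (simp add: g_def)
  have P'eq: "tri (\<lambda>i j l. k (h (c i j l))) (column i P') (column j P') (column l P') = g * k (h (c i j l))" for i j l
    using arg_cong[OF P, of ev i j l]
    by (simp add: hom_tri[OF ev] ev_const unital_hom.homs[OF ev] g_def colP')
  define C where "C = F' ** (P' ** G')"
  have "tri (diag_array (\<lambda>m. k (a m))) (column i C) (column j C) (column l C) = g * diag_array (\<lambda>m. k (a m)) i j l" for i j l
    unfolding C_def by (rule tri_conjugate_similitude[OF F'eq P'eq F'G'])
  from diagonal_similitude_factor[OF _ g0 this, of e] obtain m where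
    m: "g * k (a e) = k (a m) * C $ m $ e ^ 3" using a k0 by auto
  hence "C $ m $ e \<noteq> 0" using g0 a k0 by force
  have "Polynomial.order r (g * k (a e)) = 3 * Polynomial.order r (ev q) + 2"
    using g0 a k0 q0 \<Phi>0 r by (simp add: order_mult g_def order_cube power2_eq_square k_def order_smult)
  moreover have "Polynomial.order r (k (a m) * C $ m $ e ^ 3) = 3 * Polynomial.order r (C $ m $ e)"
    using \<open>C $ m $ e \<noteq> 0\<close> a by (simp add: k_def order_smult order_cube)
  ultimately have "3 * Polynomial.order r (ev q) + 2 = 3 * Polynomial.order r (C $ m $ e)"
    by (simp add: m)
  thus False by presburger
qed

text \<open>
  In dimension one, the equation says that \<open>c^2\<close> is a cube in \<open>k(X)\<close>.  Comparing leading coefficients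
  after the substitution of a univariate polynomial for \<open>X\<close> shows that it is a cube in \<open>k\<close>, and then so
  is \<open>c = c^3 / c^2\<close>.  Substituting polynomials instead of scalars leaves room to avoid the zeros
  of \<open>p\<close> even when \<open>k\<close> is finite.
\<close>
lemma cube_if_similitude_dimension_one:
  fixes c :: "'k::field" and p q :: "('n::finite \<Rightarrow>\<^sub>0 nat) \<Rightarrow>\<^sub>0 'k"
  assumes c: "c \<noteq> 0" and p: "p \<noteq> 0"
    and eq: "p ^ 3 = q ^ 3 * Poly_Mapping.single 0 c ^ 2 * Poly_Mapping.single (Poly_Mapping.single i 1) 1 ^ 6"
  shows "\<exists>d. c = d ^ 3"
proof -
  have H: "unital_hom (\<lambda>c::'k. [:c:])" by (rule unital_hom_const_poly)
  obtain x :: "'k poly ^ 'n" where x: "meval (\<lambda>c. [:c:]) x p \<noteq> 0"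
    using exists_meval_nonzero[OF infinite_UNIV_poly H p] by blast
  define ev where "ev = meval (\<lambda>c::'k. [:c:]) x"
  have ev: "unital_hom ev" unfolding ev_def by (rule unital_hom_meval[OF H])
  have "ev (Poly_Mapping.single (Poly_Mapping.single i 1) 1) = x $ i" "ev (Poly_Mapping.single 0 c) = [:c:]"
    unfolding ev_def by (rule meval_var[OF H], rule meval_const[OF H])
  hence "ev p ^ 3 = ev q ^ 3 * [:c:] ^ 2 * (x $ i) ^ 6"
    using arg_cong[OF eq, of ev] by (simp only: unital_hom.homs[OF ev])
  hence "Polynomial.lead_coeff (ev p ^ 3) = Polynomial.lead_coeff (ev q ^ 3 * [:c:] ^ 2 * (x $ i) ^ 6)" by simp
  hence l: "Polynomial.lead_coeff (ev p) ^ 3 = Polynomial.lead_coeff (ev q) ^ 3 * c ^ 2 * Polynomial.lead_coeff (x $ i) ^ 6"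
    by (simp add: Polynomial.lead_coeff_mult Polynomial.lead_coeff_power del: pCons_eq_0_iff)
  define \<alpha> \<beta> where "\<alpha> = Polynomial.lead_coeff (ev p)" and "\<beta> = Polynomial.lead_coeff (ev q) * Polynomial.lead_coeff (x $ i) ^ 2"
  have "\<alpha> \<noteq> 0" using x by (simp add: \<alpha>_def ev_def)
  have "c * \<alpha> ^ 3 = (c * \<beta>) ^ 3"
    using l by (simp add: \<alpha>_def \<beta>_def eval_nat_numeral mult_ac)
  hence "c = (c * \<beta> / \<alpha>) ^ 3" using \<open>\<alpha> \<noteq> 0\<close> by (simp add: power_divide field_simps)
  thus ?thesis ..
qed

section \<open>From rational functions to polynomials\<close>

lemma common_denominator:
  fixes S :: "'a::idom fract set"
  assumes "finite S"
  shows "\<exists>q. q \<noteq> 0 \<and> (\<forall>x\<in>S. \<exists>p. Fract p 1 = Fract q 1 * x)"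
  using assms
proof (induction S rule: finite_induct)
  case empty
  show ?case by (intro exI[of _ 1]) auto
next
  case (insert x S)
  then obtain q where q: "q \<noteq> 0" "\<And>y. y \<in> S \<Longrightarrow> \<exists>p. Fract p 1 = Fract q 1 * y" by blast
  obtain a d where x: "x = Fract a d" "d \<noteq> 0" by (cases x) auto
  have "\<exists>p. Fract p 1 = Fract (q * d) 1 * y" if y: "y \<in> insert x S" for y
  proof (cases "y = x")
    case True
    have "Fract (q * a) 1 = Fract (q * d) 1 * y" using x by (simp add: True eq_fract)
    thus ?thesis ..
  next
    case False
    hence "y \<in> S" using y by simp
    from q(2)[OF this] obtain p where p: "Fract p 1 = Fract q 1 * y" ..
    have "Fract (p * d) 1 = Fract p 1 * Fract d 1" by simp
    also have "\<dots> = Fract q 1 * Fract d 1 * y" by (simp only: p mult_ac)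
    finally have "Fract (p * d) 1 = Fract (q * d) 1 * y" by simp
    thus ?thesis ..
  qed
  thus ?case using q(1) x(2) by (intro exI[of _ "q * d"]) auto
qed

lemma unital_hom_rf_const: "unital_hom (rf_const :: 'k::field \<Rightarrow> ('n::{finite,linorder}, 'k) ratfun)"
  unfolding rf_const_def by (rule unital_hom_compose[OF unital_hom_single unital_hom_Fract])

text \<open>
  Strong Jordan multiplicativity in terms of polynomials: after polarization, the isomorphism over
  \<open>k(X)\<close> is described by its values on the basis vectors, and clearing the denominators of their finitely
  many components leaves an identity over \<open>k[X]\<close>, into which points can be substituted.
\<close>
lemma similitude_over_polynomials:
  fixes c :: "'n::{finite,linorder} \<Rightarrow> 'n \<Rightarrow> 'n \<Rightarrow> 'k::field"
  assumes six: "(6::'k) \<noteq> 0" and sym: "symmetric3 c"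
    and iso: "isomorphic_forms (*s)
      (\<lambda>x. (tri (\<lambda>i j l. rf_const (c i j l)) generic_vec generic_vec generic_vec) ^ 2 * tri (\<lambda>i j l. rf_const (c i j l)) x x x)
      (*s) (\<lambda>x. tri (\<lambda>i j l. rf_const (c i j l)) x x x)"
  defines "gen \<equiv> \<chi> i. Poly_Mapping.single (Poly_Mapping.single i 1) 1"
    and "C \<equiv> \<lambda>i j l. Poly_Mapping.single 0 (c i j l)"
  shows "\<exists>(P :: ((('n \<Rightarrow>\<^sub>0 nat) \<Rightarrow>\<^sub>0 'k, 'n) vec, 'n) vec) q. q \<noteq> 0 \<and> (\<forall>i j l.
    tri C (column i P) (column j P) (column l P) = q ^ 3 * (tri C gen gen gen) ^ 2 * C i j l)"
proof -
  define K :: "'n \<Rightarrow> 'n \<Rightarrow> 'n \<Rightarrow> ('n, 'k) ratfun" where "K = (\<lambda>i j l. rf_const (c i j l))"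
  define g :: "('n, 'k) ratfun" where "g = (tri K generic_vec generic_vec generic_vec) ^ 2"
  define e :: "(('n \<Rightarrow>\<^sub>0 nat) \<Rightarrow>\<^sub>0 'k) \<Rightarrow> ('n, 'k) ratfun" where "e = (\<lambda>p. Fract p 1)"
  have e: "unital_hom e" unfolding e_def by (rule unital_hom_Fract)
  have e_inj: "p = p'" if "e p = e p'" for p p' using that by (simp add: e_def eq_fract)
  have eC: "e (C i j l) = K i j l" for i j l by (simp add: e_def C_def K_def rf_const_def)
  have egen: "(\<chi> i. e (gen $ i)) = generic_vec"
    by (simp add: e_def gen_def generic_vec_def)
  have six': "(6::('n, 'k) ratfun) \<noteq> 0"
  proof -
    have "rf_const (6::'k) = (6::('n, 'k) ratfun)"
      by (rule unital_hom.hom_numeral[OF unital_hom_rf_const])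
    thus ?thesis using six unital_hom_field_eq_0_iff[OF unital_hom_rf_const, of "6::'k"] by metis
  qed
  obtain f where f: "Vector_Spaces.linear (*s) (*s) f" "\<And>x. tri K (f x) (f x) (f x) = g * tri K x x x"
    using iso unfolding isomorphic_forms_def K_def g_def by blast
  have symK: "symmetric3 K" "symmetric3 (\<lambda>i j l. g * K i j l)"
    using sym unfolding K_def symmetric3_def by simp_all
  have id: "Vector_Spaces.linear (*s) (*s) (\<lambda>x::(('n, 'k) ratfun, 'n) vec. x)"
    by (rule vec.linear_ident)
  have pol: "tri K (f u) (f v) (f w) = tri (\<lambda>i j l. g * K i j l) u v w" for u v w
    by (rule tri_polarization[OF six' symK f(1) id]) (simp add: f(2) tri_array_scale)
  have "finite (range (\<lambda>(i, m). f (axis i 1) $ m))" by simp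
  from common_denominator[OF this] obtain q where q: "q \<noteq> 0" "\<And>i m. \<exists>p. e p = e q * f (axis i 1) $ m"
    unfolding e_def by fastforce
  then obtain p where p: "\<And>i m. e (p i m) = e q * f (axis i 1) $ m" by metis
  define P where "P = (\<chi> m i. p i m)"
  have colP: "(\<chi> m. e (column i P $ m)) = e q *s f (axis i 1)" for i
    by (simp add: P_def column_def vec_eq_iff p)
  have "tri C (column i P) (column j P) (column l P) = q ^ 3 * (tri C gen gen gen) ^ 2 * C i j l" for i j l
  proof (rule e_inj)
    have "e (tri C (column i P) (column j P) (column l P)) = e q ^ 3 * (g * K i j l)"
      by (simp add: hom_tri[OF e] eC colP tri_scale pol tri_axis power3_eq_cube mult_ac)
    also have "\<dots> = e (q ^ 3 * (tri C gen gen gen) ^ 2 * C i j l)"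
      by (simp add: unital_hom.homs[OF e] hom_tri[OF e] eC egen g_def mult_ac)
    finally show "e (tri C (column i P) (column j P) (column l P)) = e (q ^ 3 * (tri C gen gen gen) ^ 2 * C i j l)" .
  qed
  with q(1) show ?thesis by (intro exI conjI allI)
qed

section \<open>Forms in coordinates\<close>

lemma linear_map_coords:
  assumes "is_basis scl b"
  shows "Vector_Spaces.linear scl (*s) (coords scl b)"
proof -
  interpret vector_space scl using assms by (simp add: is_basis_def)
  show ?thesis
    by unfold_locales (rule linear_coords[OF assms])+
qed

lemma coords_linear_combination:
  assumes "is_basis scl b"
  shows "coords scl b (\<Sum>i\<in>UNIV. scl (x $ i) (b i)) = x"
proof -
  interpret Vector_Spaces.linear scl "(*s)" "coords scl b" by (rule linear_map_coords[OF assms])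
  show ?thesis
    by (simp add: sum scale linear_coords(3)[OF assms] basis_expansion)
qed

lemma linear_combination_coords:
  assumes "is_basis scl b"
  shows "(\<Sum>i\<in>UNIV. scl (coords scl b v $ i) (b i)) = v"
proof -
  interpret vector_space scl using assms by (simp add: is_basis_def)
  have b: "inj b" "independent (range b)" "span (range b) = UNIV"
    using assms by (simp_all add: is_basis_def)
  have "(\<Sum>y\<in>range b. scl (representation (range b) v y) y) = v"
    by (rule sum_representation_eq) (use b in auto)
  thus ?thesis using b(1) by (simp add: sum.reindex coords_def)
qed

text \<open>
  In coordinates the polar form is given by a symmetric array, which reduces all notions in the
  theorem to arrays.
\<close>
lemma cubic_form_array:
  fixes scl :: "'k::field \<Rightarrow> 'v::ab_group_add \<Rightarrow> 'v" and b :: "'n::finite \<Rightarrow> 'v"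
  assumes six: "(6::'k) \<noteq> 0" and b: "is_basis scl b" and "cubic_form scl b \<phi>"
  shows "\<exists>c. symmetric3 c \<and>
    (\<forall>u v w. polar_form scl \<phi> u v w = tri c (coords scl b u) (coords scl b v) (coords scl b w)) \<and>
    (\<forall>v. \<phi> v = tri c (coords scl b v) (coords scl b v) (coords scl b v))"
proof -
  obtain p where p: "homogeneous_poly 3 p" "\<And>v. \<phi> v = poly_eval p (coords scl b v)"
    using assms(3) unfolding cubic_form_def by blast
  obtain c where c: "symmetric3 c" "\<And>x. poly_eval p x = tri c x x x"
    using homogeneous_poly_array[OF six p(1), of "\<lambda>x. x"] unfolding tri_def by auto
  have pf: "polar_form scl \<phi> = (\<lambda>u v w. tri c (coords scl b u) (coords scl b v) (coords scl b w))"
    using symmetric3_tri[OF c(1)]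
    by (intro polar_form_eqI[OF six] trilinear_tri linear_map_coords[OF b])
      (auto simp: symmetric3_def p(2) c(2))
  show ?thesis
    using c(1) by (intro exI[of _ c]) (simp add: pf p(2) c(2))
qed

lemma single_eq_0_iff: "Poly_Mapping.single m v = 0 \<longleftrightarrow> v = 0"
  by (metis lookup_single_eq lookup_zero single_zero)

lemma cubic_equation_cancel:
  fixes t :: "'r::idom"
  assumes "t \<noteq> 0" "q \<noteq> 0" "z \<noteq> 0" and eq: "t * p * p * p = q ^ 3 * (t * z * z * z) ^ 2 * t"
  shows "p ^ 3 = q ^ 3 * t ^ 2 * z ^ 6" and "p \<noteq> 0"
proof -
  have "t * p ^ 3 = t * (q ^ 3 * t ^ 2 * z ^ 6)"
    using eq by (simp add: eval_nat_numeral mult_ac)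
  thus "p ^ 3 = q ^ 3 * t ^ 2 * z ^ 6" using assms(1) by simp
  hence "p ^ 3 \<noteq> 0" using assms(1-3) by simp
  thus "p \<noteq> 0" by auto
qed

lemma isomorphic_to_cube_form_dimension_one:
  fixes scl :: "'k::field \<Rightarrow> 'v::ab_group_add \<Rightarrow> 'v" and b :: "'n::finite \<Rightarrow> 'v"
  assumes b: "is_basis scl b" and U: "(UNIV :: 'n set) = {i}"
    and \<phi>: "\<And>v. \<phi> v = d ^ 3 * coords scl b v $ i ^ 3" and "d \<noteq> 0"
  shows "isomorphic_forms scl \<phi> (*s) (diag_form (\<lambda>_::1. 1 :: 'k))"
proof -
  interpret L: Vector_Spaces.linear scl "(*s)" "coords scl b" by (rule linear_map_coords[OF b])
  define f :: "'v \<Rightarrow> 'k ^ 1" where "f = (\<lambda>v. \<chi> _. d * coords scl b v $ i)"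
  have comb: "scl (coords scl b v $ i) (b i) = v" for v
    using linear_combination_coords[OF b, of v] by (simp add: U)
  have comb': "coords scl b (scl x (b i)) $ i = x" for x
    using coords_linear_combination[OF b, of "\<chi> _. x"] by (simp add: U)
  have "Vector_Spaces.linear scl (*s) f"
    by unfold_locales (simp_all add: f_def L.add L.scale vec_eq_iff algebra_simps)
  moreover have "bij f"
  proof (rule bij_betw_byWitness[where f' = "\<lambda>y. scl (y $ 1 / d) (b i)"])
    show "\<forall>v\<in>UNIV. scl (f v $ 1 / d) (b i) = v" using \<open>d \<noteq> 0\<close> by (simp add: f_def comb)
    show "\<forall>y\<in>UNIV. f (scl (y $ 1 / d) (b i)) = y" using \<open>d \<noteq> 0\<close> by (simp add: f_def comb' vec_eq_iff)
  qed auto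
  moreover have "diag_form (\<lambda>_::1. 1 :: 'k) (f v) = \<phi> v" for v
    by (simp add: diag_form_def f_def \<phi> power_mult_distrib)
  ultimately show ?thesis unfolding isomorphic_forms_def by blast
qed

text \<open>
  Polarization turns the isomorphism into an identity of arrays; the columns of \<open>F\<close> are the
  coordinates of the images of the basis vectors.
\<close>
lemma diagonal_imp_diagonal_array:
  fixes scl :: "'k::field \<Rightarrow> 'v::ab_group_add \<Rightarrow> 'v" and b :: "'n::finite \<Rightarrow> 'v"
  assumes six: "(6::'k) \<noteq> 0" and b: "is_basis scl b" and sym: "symmetric3 c"
    and \<phi>: "\<And>v. \<phi> v = tri c (coords scl b v) (coords scl b v) (coords scl b v)"
    and "diagonal scl b \<phi>"
  shows "\<exists>a (F :: 'k ^ 'n ^ 'n). \<forall>i j l. c i j l = tri (diag_array a) (column i F) (column j F) (column l F)"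
proof -
  obtain a where "isomorphic_forms scl \<phi> scl (\<lambda>v. diag_form a (coords scl b v))"
    using assms(5) unfolding diagonal_def ..
  then obtain f where f: "Vector_Spaces.linear scl scl f \<and> bij f \<and> (\<forall>v. diag_form a (coords scl b (f v)) = \<phi> v)"
    unfolding isomorphic_forms_def ..
  define F where "F = (\<chi> m i. coords scl b (f (b i)) $ m)"
  have col: "column i F = coords scl b (f (b i))" for i by (simp add: F_def column_def)
  have "Vector_Spaces.linear scl (*s) (coords scl b \<circ> f)"
    by (rule Vector_Spaces.linear_compose[OF conjunct1[OF f] linear_map_coords[OF b]])
  hence lin: "Vector_Spaces.linear scl (*s) (\<lambda>v. coords scl b (f v))" by (simp add: o_def)
  have eq: "tri c (coords scl b v) (coords scl b v) (coords scl b v)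
      = tri (diag_array a) (coords scl b (f v)) (coords scl b (f v)) (coords scl b (f v))" for v
    using f by (simp flip: diag_form_eq_tri \<phi>)
  have "tri c (coords scl b (b i)) (coords scl b (b j)) (coords scl b (b l))
      = tri (diag_array a) (coords scl b (f (b i))) (coords scl b (f (b j))) (coords scl b (f (b l)))" for i j l
    by (rule tri_polarization[OF six sym symmetric3_diag_array linear_map_coords[OF b] lin eq])
  hence "c i j l = tri (diag_array a) (column i F) (column j F) (column l F)" for i j l
    by (simp add: linear_coords(3)[OF b] tri_axis col)
  thus ?thesis by (intro exI allI)
qed

lemma isomorphic_diag_form_imp_diagonal_array:
  fixes c :: "'n::finite \<Rightarrow> 'n \<Rightarrow> 'n \<Rightarrow> 'l::field"
  assumes six: "(6::'l) \<noteq> 0" and sym: "symmetric3 c"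
    and iso: "isomorphic_forms (*s) (\<lambda>x. tri c x x x) (*s) (diag_form a)"
  shows "\<exists>F :: 'l ^ 'n ^ 'n. \<forall>i j l. c i j l = tri (diag_array a) (column i F) (column j F) (column l F)"
proof -
  obtain f where f: "Vector_Spaces.linear (*s) (*s) f \<and> bij f \<and> (\<forall>x. diag_form a (f x) = tri c x x x)"
    using iso unfolding isomorphic_forms_def ..
  define F where "F = (\<chi> m i. f (axis i 1) $ m)"
  have col: "column i F = f (axis i 1)" for i by (simp add: F_def column_def)
  have eq: "tri c x x x = tri (diag_array a) (f x) (f x) (f x)" for x
    using f by (simp flip: diag_form_eq_tri)
  have "tri c u v w = tri (diag_array a) (f u) (f v) (f w)" for u v w
    by (rule tri_polarization[OF six sym symmetric3_diag_array vec.linear_ident conjunct1[OF f] eq])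
  from this[of "axis i 1" "axis j 1" "axis l 1" for i j l]
  have "c i j l = tri (diag_array a) (column i F) (column j F) (column l F)" for i j l
    by (simp add: col tri_axis)
  thus ?thesis by (intro exI allI)
qed

section \<open>Strongly Jordan multiplicative forms\<close>

theorem proposition4:
  fixes scl :: "'k::field \<Rightarrow> 'v::ab_group_add \<Rightarrow> 'v"
    and b :: "'n::{finite,linorder} \<Rightarrow> 'v"
    and \<phi> :: "'v \<Rightarrow> 'k"
  assumes "CHAR('k) = 0 \<or> CHAR('k) > 3"
    and "is_basis scl b"
    and "cubic_form scl b \<phi>"
    and "nondegenerate scl \<phi>"
    and "strongly_Jordan_multiplicative scl b \<phi>"
  shows "(diagonal scl b \<phi> \<longrightarrow> isomorphic_forms scl \<phi> (*s) (diag_form (\<lambda>_::1. 1 :: 'k))) \<and>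
         (separable scl b \<phi> \<longrightarrow> isomorphic_forms scl \<phi> (*s) (diag_form (\<lambda>_::1. 1 :: 'k)))"
proof -
  note six = six_nonzero[OF assms(1)]
  note b = assms(2)
  from cubic_form_array[OF six b assms(3)] obtain c where
    "symmetric3 c \<and>
    (\<forall>u v w. polar_form scl \<phi> u v w = tri c (coords scl b u) (coords scl b v) (coords scl b w)) \<and>
    (\<forall>v. \<phi> v = tri c (coords scl b v) (coords scl b v) (coords scl b v))" ..
  hence sym: "symmetric3 c"
    and polar: "\<And>u v w. polar_form scl \<phi> u v w = tri c (coords scl b u) (coords scl b v) (coords scl b w)"
    and \<phi>: "\<And>v. \<phi> v = tri c (coords scl b v) (coords scl b v) (coords scl b v)"
    by simp_all
  have c: "polar_form scl \<phi> (b i) (b j) (b l) = c i j l" for i j l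
    by (simp add: polar linear_coords(3)[OF b] tri_axis)
  have extend: "extend_form h scl b \<phi> = (\<lambda>x. tri (\<lambda>i j l. h (c i j l)) x x x)" for h :: "'k \<Rightarrow> 'x::field"
    by (simp add: fun_eq_iff extend_form_def tri_def c)
  interpret L: Vector_Spaces.linear scl "(*s)" "coords scl b" by (rule linear_map_coords[OF b])
  have nondeg: "x = 0" if "\<And>v w. tri c x v w = 0" for x
  proof -
    have "(\<Sum>i\<in>UNIV. scl (x $ i) (b i)) = 0"
      using assms(4) that unfolding nondegenerate_def polar by (simp add: coords_linear_combination[OF b])
    thus ?thesis using coords_linear_combination[OF b, of x] by simp
  qed

  define gen :: "(('n \<Rightarrow>\<^sub>0 nat) \<Rightarrow>\<^sub>0 'k, 'n) vec" where "gen = (\<chi> i. Poly_Mapping.single (Poly_Mapping.single i 1) 1)"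
  define C :: "'n \<Rightarrow> 'n \<Rightarrow> 'n \<Rightarrow> ('n \<Rightarrow>\<^sub>0 nat) \<Rightarrow>\<^sub>0 'k" where "C = (\<lambda>i j l. Poly_Mapping.single 0 (c i j l))"
  have "\<exists>(P :: ((('n \<Rightarrow>\<^sub>0 nat) \<Rightarrow>\<^sub>0 'k, 'n) vec, 'n) vec) q. q \<noteq> 0 \<and> (\<forall>i j l.
      tri C (column i P) (column j P) (column l P) = q ^ 3 * (tri C gen gen gen) ^ 2 * C i j l)"
    unfolding gen_def C_def
    by (rule similitude_over_polynomials[OF six sym])
      (use assms(5) in \<open>simp only: strongly_Jordan_multiplicative_def extend Let_def\<close>)
  then obtain P :: "((('n \<Rightarrow>\<^sub>0 nat) \<Rightarrow>\<^sub>0 'k, 'n) vec, 'n) vec" and q where Pq: "q \<noteq> 0 \<and> (\<forall>i j l.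
      tri C (column i P) (column j P) (column l P) = q ^ 3 * (tri C gen gen gen) ^ 2 * C i j l)"
    by (elim exE) (rule that)
  note q = conjunct1[OF Pq] and P = conjunct2[OF Pq, rule_format]

  have one_dim: "isomorphic_forms scl \<phi> (*s) (diag_form (\<lambda>_::1. 1 :: 'k))" if n: "CARD('n) = 1"
  proof -
    \<comment> \<open>The array has a single entry \<open>c i i i\<close>, and the similitude is multiplication by \<open>p / q\<close>.\<close>
    obtain i :: 'n where U: "(UNIV :: 'n set) = {i}" using n card_1_singletonE by blast
    have tri1: "tri d u v w = d i i i * u $ i * v $ i * w $ i" for d :: "'n \<Rightarrow> 'n \<Rightarrow> 'n \<Rightarrow> 'r::comm_ring_1" and u v w
      by (simp add: tri_def U)
    have c0: "c i i i \<noteq> 0"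
    proof
      assume "c i i i = 0"
      hence "axis i (1::'k) = 0" by (intro nondeg) (simp add: tri1)
      thus False by simp
    qed
    define p where "p = P $ i $ i"
    define z where "z = (Poly_Mapping.single (Poly_Mapping.single i 1) 1 :: ('n \<Rightarrow>\<^sub>0 nat) \<Rightarrow>\<^sub>0 'k)"
    have C0: "C i i i \<noteq> 0" using c0 by (simp add: C_def single_eq_0_iff)
    have z0: "z \<noteq> 0" by (simp add: z_def single_eq_0_iff)
    have tP: "tri C (column i P) (column i P) (column i P) = C i i i * p * p * p"
      unfolding tri1 p_def column_def vec_lambda_beta ..
    have tX: "tri C gen gen gen = C i i i * z * z * z"
      unfolding tri1 gen_def z_def vec_lambda_beta ..
    have "C i i i * p * p * p = q ^ 3 * (C i i i * z * z * z) ^ 2 * C i i i"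
      by (rule P[of i i i, unfolded tP tX])
    note eq = cubic_equation_cancel[OF C0 q z0 this]
    from cube_if_similitude_dimension_one[OF c0 eq(2) eq(1)[unfolded C_def z_def]]
    obtain d where d: "c i i i = d ^ 3" ..
    have "d \<noteq> 0" using d c0 by auto
    have "\<phi> v = d ^ 3 * coords scl b v $ i ^ 3" for v
      by (simp add: \<phi> tri1 d power3_eq_cube mult_ac)
    thus ?thesis by (rule isomorphic_to_cube_form_dimension_one[OF b U _ \<open>d \<noteq> 0\<close>])
  qed

  have three: "(3::'k alg_closure) \<noteq> 0"
  proof
    assume "(3::'k alg_closure) = 0"
    hence "to_ac (3::'k) = to_ac 0" by simp
    hence "(3::'k) = 0" by (simp only: to_ac_eq_iff)
    hence "(2 * 3::'k) = 0" by simp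
    thus False using six by simp
  qed
  \<comment> \<open>A diagonalization over the algebraic closure suffices.  A diagonal form over \<open>k\<close> has one by extension of scalars.\<close>
  have dim: "CARD('n) = 1"
    if F: "\<And>i j l. to_ac (c i j l) = tri (diag_array a) (column i F) (column j F) (column l F)"
    for a and F :: "(('k alg_closure, 'n) vec, 'n) vec"
  proof -
    obtain G where G: "F ** G = mat 1"
      using diagonalizing_matrix_invertible(1)[OF unital_hom_to_ac nondeg F] by blast
    show ?thesis
      by (rule dimension_one_if_similitude[OF three unital_hom_to_ac F G
            diagonalizing_matrix_invertible(2)[OF unital_hom_to_ac nondeg F] gen_def refl q P[unfolded C_def]])
  qed
  have "CARD('n) = 1" if "diagonal scl b \<phi>"
  proof -
    from diagonal_imp_diagonal_array[OF six b sym \<phi> that] obtain a and F :: "(('k, 'n) vec, 'n) vec"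
      where F: "\<forall>i j l. c i j l = tri (diag_array a) (column i F) (column j F) (column l F)"
      by (elim exE) (rule that)
    define F' where "F' = (\<chi> m i. to_ac (F $ m $ i))"
    have col: "column i F' = (\<chi> m. to_ac (column i F $ m))" for i by (simp add: F'_def column_def)
    show ?thesis
    proof (rule dim)
      show "to_ac (c i j l) = tri (diag_array (\<lambda>m. to_ac (a m))) (column i F') (column j F') (column l F')" for i j l
        by (simp add: F[rule_format] hom_tri[OF unital_hom_to_ac] hom_diag_array col)
    qed
  qed
  moreover have "CARD('n) = 1" if "separable scl b \<phi>"
  proof -
    have "(6::'k alg_closure) \<noteq> 0"
      using six to_ac_eq_0_iff[of "6::'k"] by simp
    moreover have "symmetric3 (\<lambda>i j l. to_ac (c i j l))" using sym by (simp add: symmetric3_def)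
    moreover obtain a :: "'n \<Rightarrow> 'k alg_closure" where "isomorphic_forms (*s) (\<lambda>x. tri (\<lambda>i j l. to_ac (c i j l)) x x x) (*s) (diag_form a)"
      using \<open>separable scl b \<phi>\<close> unfolding separable_def extend ..
    ultimately obtain F :: "(('k alg_closure, 'n) vec, 'n) vec"
      where "\<forall>i j l. to_ac (c i j l) = tri (diag_array a) (column i F) (column j F) (column l F)"
      using isomorphic_diag_form_imp_diagonal_array by blast
    thus ?thesis by (intro dim) simp
  qed
  ultimately show ?thesis using one_dim by blast
qed

end
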